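(* Let $A$ be a von Neumann algebra. A state $\psi:A\to\mathbb{C}$ defines a probability valuation $\mu_{\psi}$ on the spectral presheaf $\underline{\Sigma}_A$ (regarded as a topological space internal to the topos $[\mathcal{C}^{op},\mathbf{Set}]$).
   Context: $\mathcal{C}$ is the poset (under inclusion) of abelian von Neumann subalgebras of $A$ (containing the unit of $A$), and $\downarrow C=\{D\in\mathcal{C}\mid D\subseteq C\}$. $\Sigma_C$ is the Gelfand spectrum of $C$; the spectral presheaf $\underline{\Sigma}_A$ is $C\mapsto\Sigma_C$ with restriction maps $\lambda\mapsto\lambda|_D$ for $D\subseteq C$. A state is a positive normalised linear functional. $\mathrm{OR}(\downarrow C,[0,1])$ is the set of order-reversing functions $\downarrow C\to[0,1]$. $\Sigma^{\downarrow}_A$ is the set $\coprod_{C\in\mathcal{C}}\Sigma_C$ with $U$ open iff (1) $(C,\lambda)\in U$ and $D\subseteq C$ imply $(D,\lambda|_D)\in U$, and (2) $U\cap\Sigma_C$ is open in $\Sigma_C$ for every $C$. $\Sigma^{\downarrow}_C=\coprod_{D\subseteq C}\Sigma_D$ carries the subspace topology. $\underline{\Sigma}_A$ is regarded as an internal topological space (with the topology generated by the clopen subobjects) whose internal frame of opens $\mathcal{O}\underline{\Sigma}_A$ is the presheaf $C\mapsto\mathcal{O}\Sigma^{\downarrow}_C$ (with restriction $U\mapsto U\cap\Sigma^{\downarrow}_D$), and $\underline{[0,1]}_l$, the internal lower reals between $0$ and $1$, is the presheaf $C\mapsto\mathrm{OR}(\downarrow C,[0,1])$ (with restriction of functions).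 A probability valuation on a locale $X$ (in particular, on a topological space) in a topos is a function $\mu:\mathcal{O}X\to[0,1]_l$ (lower reals between 0 and 1) that is monotone, satisfies $\mu(\bot)=0$, $\mu(\top)=1$, $\mu(U)+\mu(V)=\mu(U\wedge V)+\mu(U\vee V)$, and preserves directed joins. Externally, for $\underline{\Sigma}_A$ this amounts to functions $\mu_C:\mathcal{O}\Sigma^{\downarrow}_C\to\mathrm{OR}(\downarrow C,[0,1])$, $C\in\mathcal{C}$, with $\mu_C(U)(D)=\mu_D(U\cap\Sigma^{\downarrow}_D)(D)$ for $D\subseteq C$, and such that for all $D\subseteq C$: $U\subseteq V$ implies $\mu_C(U)(D)\leq\mu_C(V)(D)$; $\mu_C(\Sigma_C^{\downarrow})(D)=1$ and $\mu_C(\emptyset)(D)=0$; $\mu_C(U)(D)+\mu_C(V)(D)=\mu_C(U\cap V)(D)+\mu_C(U\cup V)(D)$; and $\mu_C(\bigcup_\lambda U_\lambda)(D)=\sup_\lambda\mu_C(U_\lambda)(D)$ for directed families $\{U_\lambda\}$. Meaning of the notation $\mu_\psi$: for $D\in\mathcal{C}$ let $\mu_\psi^{(D)}:\mathcal{O}\Sigma_D\to[0,1]$ be the probability valuation corresponding to the state $\psi|_D$ by the Riesz–Markov theorem; then $\mu_\psi$ denotes the family $(\mu_\psi)_C(U)(D)=\mu_\psi^{(D)}(U\cap\Sigma_D)$ for $D\subseteq C$, $U\in\mathcal{O}\Sigma^{\downarrow}_C$. *)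

theory Defs
  imports "HOL-Probability.Probability_Measure"
begin

section \<open>Complex Hilbert spaces and von Neumann algebras\<close>

text \<open>Type variables of the following class range over the complex Hilbert spaces; the underlying
  real Hilbert space structure is that of \<^class>\<open>real_inner\<close>. The inner product is linear in its
  second argument.\<close>

class chilbert_space = real_inner + banach +
  fixes scaleC :: "complex \<Rightarrow> 'a \<Rightarrow> 'a" (infixr "*\<^sub>C" 75)
    and cinner :: "'a \<Rightarrow> 'a \<Rightarrow> complex"
  assumes scaleC_add_right: "c *\<^sub>C (x + y) = c *\<^sub>C x + c *\<^sub>C y"
    and scaleC_add_left: "(c + d) *\<^sub>C x = c *\<^sub>C x + d *\<^sub>C x"
    and scaleC_scaleC: "c *\<^sub>C d *\<^sub>C x = (c * d) *\<^sub>C x"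
    and scaleC_of_real: "complex_of_real r *\<^sub>C x = r *\<^sub>R x"
    and cinner_add_right: "cinner x (y + z) = cinner x y + cinner x z"
    and cinner_scaleC_right: "cinner x (c *\<^sub>C y) = c * cinner x y"
    and cinner_commute: "cinner x y = cnj (cinner y x)"
    and Re_cinner: "Re (cinner x y) = inner x y"

lemma cinner_self: "cinner x x = complex_of_real ((norm x)\<^sup>2)"
proof (rule complex_eqI)
  show "Re (cinner x x) = Re (complex_of_real ((norm x)\<^sup>2))"
    by (simp only: Re_cinner power2_norm_eq_inner Re_complex_of_real)
  have "Im (cinner x x) = - Im (cinner x x)"
    using arg_cong[OF cinner_commute[of x x], of Im] by (simp only: cnj.sel)
  then show "Im (cinner x x) = Im (complex_of_real ((norm x)\<^sup>2))"
    by simp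
qed

lemma norm_scaleC: "norm (c *\<^sub>C x) = cmod c * norm x"
proof -
  have "cinner (c *\<^sub>C x) x = cnj (c * cinner x x)"
    by (subst cinner_commute) (simp only: cinner_scaleC_right)
  then have "cinner (c *\<^sub>C x) (c *\<^sub>C x) = c * cnj c * cinner x x"
    by (simp only: cinner_scaleC_right complex_cnj_mult cinner_commute[of x x, symmetric] mult.assoc)
  then have "complex_of_real ((norm (c *\<^sub>C x))\<^sup>2) = of_real ((cmod c * norm x)\<^sup>2)"
    by (simp only: cinner_self complex_norm_square[symmetric] power_mult_distrib of_real_mult)
  then have "(norm (c *\<^sub>C x))\<^sup>2 = (cmod c * norm x)\<^sup>2"
    by (simp only: of_real_eq_iff)
  then show ?thesis
    by (simp add: power2_eq_iff_nonneg)
qed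

lemma bounded_linear_scaleC: "bounded_linear (\<lambda>x::'h::chilbert_space. c *\<^sub>C x)"
proof (rule bounded_linear_intro[where K = "cmod c"])
  fix r :: real and x y :: 'h
  show "c *\<^sub>C (x + y) = c *\<^sub>C x + c *\<^sub>C y"
    by (rule scaleC_add_right)
  show "c *\<^sub>C (r *\<^sub>R x) = r *\<^sub>R (c *\<^sub>C x)"
    by (simp only: scaleC_of_real[symmetric] scaleC_scaleC mult.commute)
  show "norm (c *\<^sub>C x) \<le> norm x * cmod c"
    by (simp add: norm_scaleC)
qed

type_synonym 'h op = "'h \<Rightarrow>\<^sub>L 'h"

lift_definition scaleC_op :: "complex \<Rightarrow> 'h::chilbert_space op \<Rightarrow> 'h op"
  is "\<lambda>c T x. c *\<^sub>C T x"
  by (rule bounded_linear_compose[OF bounded_linear_scaleC])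

text \<open>The library's bounded operators are only real-linear.\<close>

definition bounded_operators :: "'h::chilbert_space op set" where
  "bounded_operators = {T :: 'h op. \<forall>c x. T (c *\<^sub>C x) = c *\<^sub>C T x}"

definition is_adjoint :: "'h::chilbert_space op \<Rightarrow> 'h op \<Rightarrow> bool" where
  "is_adjoint T S \<longleftrightarrow> (\<forall>x y. cinner (S x) y = cinner x (T y))"

definition commutant :: "'h::chilbert_space op set \<Rightarrow> 'h op set" where
  "commutant A = {T \<in> bounded_operators. \<forall>S\<in>A. T o\<^sub>L S = S o\<^sub>L T}"

text \<open>A commutant is a linear subspace closed under composition and contains the identity operator,
  so these properties are part of the bicommutant condition.\<close>

definition von_neumann_algebra :: "'h::chilbert_space op set \<Rightarrow> bool" where
  "von_neumann_algebra A \<longleftrightarrow>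
    A \<subseteq> bounded_operators \<and>
    (\<forall>T\<in>A. \<exists>S\<in>A. is_adjoint T S) \<and>
    commutant (commutant A) = A"

definition abelian :: "'h::chilbert_space op set \<Rightarrow> bool" where
  "abelian A \<longleftrightarrow> (\<forall>S\<in>A. \<forall>T\<in>A. S o\<^sub>L T = T o\<^sub>L S)"

definition linear_functional_on :: "'h::chilbert_space op set \<Rightarrow> ('h op \<Rightarrow> complex) \<Rightarrow> bool" where
  "linear_functional_on A \<phi> \<longleftrightarrow>
    (\<forall>S\<in>A. \<forall>T\<in>A. \<phi> (S + T) = \<phi> S + \<phi> T) \<and>
    (\<forall>c. \<forall>T\<in>A. \<phi> (scaleC_op c T) = c * \<phi> T)"

definition state_on :: "'h::chilbert_space op set \<Rightarrow> ('h op \<Rightarrow> complex) \<Rightarrow> bool" where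
  "state_on A \<psi> \<longleftrightarrow>
    linear_functional_on A \<psi> \<and>
    (\<forall>T\<in>A. \<forall>S. is_adjoint T S \<longrightarrow> \<psi> (S o\<^sub>L T) \<in> \<real>\<^sub>\<ge>\<^sub>0) \<and>
    \<psi> id_blinfun = 1"


section \<open>Contexts and Gelfand spectra\<close>

text \<open>All von Neumann algebras here contain the identity operator, which is therefore the common
  unit of an algebra and its von Neumann subalgebras.\<close>

definition contexts :: "'h::chilbert_space op set \<Rightarrow> 'h op set set" where
  "contexts A = {C. C \<subseteq> A \<and> von_neumann_algebra C \<and> abelian C}"

definition down :: "'h::chilbert_space op set \<Rightarrow> 'h op set \<Rightarrow> 'h op set set" where
  "down A C = {D \<in> contexts A. D \<subseteq> C}"

text \<open>Functions with domain \<open>C\<close> are represented by members of \<^term>\<open>extensional C\<close>.\<close>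

definition gelfand_spectrum :: "'h::chilbert_space op set \<Rightarrow> ('h op \<Rightarrow> complex) set" where
  "gelfand_spectrum C = {l \<in> extensional C.
    linear_functional_on C l \<and>
    (\<forall>S\<in>C. \<forall>T\<in>C. l (S o\<^sub>L T) = l S * l T) \<and>
    l id_blinfun = 1}"

text \<open>The topology of pointwise convergence on \<open>C\<close>, i.e. the weak-* topology.\<close>

definition gelfand_topology :: "'h::chilbert_space op set \<Rightarrow> ('h op \<Rightarrow> complex) topology" where
  "gelfand_topology C = subtopology (product_topology (\<lambda>_. euclidean) C) (gelfand_spectrum C)"


section \<open>The spectral presheaf as an internal space\<close>

definition Sigma_down ::
    "'h::chilbert_space op set \<Rightarrow> 'h op set \<Rightarrow> ('h op set \<times> ('h op \<Rightarrow> complex)) set" where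
  "Sigma_down A C = (SIGMA D:down A C. gelfand_spectrum D)"

text \<open>For a subset \<open>U\<close> of the coproduct of the spectra, \<open>U `` {C}\<close> is its part in the summand \<open>C\<close>.\<close>

definition open_in_Sigma ::
    "'h::chilbert_space op set \<Rightarrow> ('h op set \<times> ('h op \<Rightarrow> complex)) set \<Rightarrow> bool" where
  "open_in_Sigma A U \<longleftrightarrow>
    U \<subseteq> (SIGMA C:contexts A. gelfand_spectrum C) \<and>
    (\<forall>C l. \<forall>D\<in>contexts A. (C, l) \<in> U \<and> D \<subseteq> C \<longrightarrow> (D, restrict l D) \<in> U) \<and>
    (\<forall>C\<in>contexts A. openin (gelfand_topology C) (U `` {C}))"

lemma istopology_open_in_Sigma: "istopology (open_in_Sigma A)"
  unfolding istopology_def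
proof (intro conjI allI impI)
  fix S T assume S: "open_in_Sigma A S" and T: "open_in_Sigma A T"
  have *: "(S \<inter> T) `` {C} = S `` {C} \<inter> T `` {C}" for C by blast
  have "openin (gelfand_topology C) ((S \<inter> T) `` {C})" if "C \<in> contexts A" for C
    unfolding * using S T that by (intro openin_Int) (simp_all only: open_in_Sigma_def)
  moreover have "S \<inter> T \<subseteq> (SIGMA C:contexts A. gelfand_spectrum C)"
    using S unfolding open_in_Sigma_def by (meson le_infI1)
  moreover have "(D, restrict l D) \<in> S \<inter> T"
    if "D \<in> contexts A" "(C, l) \<in> S \<inter> T \<and> D \<subseteq> C" for C D l
    using S T that unfolding open_in_Sigma_def Int_iff by meson
  ultimately show "open_in_Sigma A (S \<inter> T)"
    unfolding open_in_Sigma_def by (intro conjI allI ballI impI)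
next
  fix K assume K: "\<forall>U\<in>K. open_in_Sigma A U"
  have *: "(\<Union>K) `` {C} = \<Union>((\<lambda>U. U `` {C}) ` K)" for C by blast
  have "openin (gelfand_topology C) ((\<Union>K) `` {C})" if "C \<in> contexts A" for C
    unfolding * by (rule openin_Union, clarify) (use K that in \<open>simp only: open_in_Sigma_def\<close>)
  moreover have "\<Union>K \<subseteq> (SIGMA C:contexts A. gelfand_spectrum C)"
    using K unfolding open_in_Sigma_def by (meson Sup_least)
  moreover have "(D, restrict l D) \<in> \<Union>K"
    if "D \<in> contexts A" "(C, l) \<in> \<Union>K \<and> D \<subseteq> C" for C D l
    using K that unfolding open_in_Sigma_def Union_iff by meson
  ultimately show "open_in_Sigma A (\<Union>K)"
    unfolding open_in_Sigma_def by (intro conjI allI ballI impI)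
qed

definition Sigma_topology ::
    "'h::chilbert_space op set \<Rightarrow> ('h op set \<times> ('h op \<Rightarrow> complex)) topology" where
  "Sigma_topology A = topology (open_in_Sigma A)"

lemma openin_Sigma_topology: "openin (Sigma_topology A) = open_in_Sigma A"
  unfolding Sigma_topology_def by (rule topology_inverse'[OF istopology_open_in_Sigma])

definition opens ::
    "'h::chilbert_space op set \<Rightarrow> 'h op set \<Rightarrow> ('h op set \<times> ('h op \<Rightarrow> complex)) set set" where
  "opens A C = {U. openin (subtopology (Sigma_topology A) (Sigma_down A C)) U}"

definition lower_reals :: "'h::chilbert_space op set \<Rightarrow> 'h op set \<Rightarrow> ('h op set \<Rightarrow> real) set" where
  "lower_reals A C = {f \<in> down A C \<rightarrow>\<^sub>E {0..1}.
    \<forall>D\<in>down A C. \<forall>E\<in>down A C. D \<subseteq> E \<longrightarrow> f E \<le> f D}"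

definition directed :: "'a set set \<Rightarrow> bool" where
  "directed F \<longleftrightarrow> F \<noteq> {} \<and> (\<forall>U\<in>F. \<forall>V\<in>F. \<exists>W\<in>F. U \<subseteq> W \<and> V \<subseteq> W)"

text \<open>A probability valuation on the spectral presheaf, internal to the presheaf topos over
  \<^term>\<open>contexts A\<close>: the first two conditions say that \<open>\<mu>\<close> is a natural transformation
  from the presheaf \<^term>\<open>opens A\<close> to the presheaf \<^term>\<open>lower_reals A\<close>.\<close>

definition probability_valuation ::
    "'h::chilbert_space op set \<Rightarrow>
     ('h op set \<Rightarrow> ('h op set \<times> ('h op \<Rightarrow> complex)) set \<Rightarrow> 'h op set \<Rightarrow> real) \<Rightarrow> bool" where
  "probability_valuation A \<mu> \<longleftrightarrow>
    (\<forall>C\<in>contexts A. \<forall>U\<in>opens A C. \<mu> C U \<in> lower_reals A C) \<and>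
    (\<forall>C\<in>contexts A. \<forall>D\<in>down A C. \<forall>U\<in>opens A C.
      \<mu> D (U \<inter> Sigma_down A D) = restrict (\<mu> C U) (down A D)) \<and>
    (\<forall>C\<in>contexts A. \<forall>D\<in>down A C.
      (\<forall>U\<in>opens A C. \<forall>V\<in>opens A C. U \<subseteq> V \<longrightarrow> \<mu> C U D \<le> \<mu> C V D) \<and>
      \<mu> C {} D = 0 \<and>
      \<mu> C (Sigma_down A C) D = 1 \<and>
      (\<forall>U\<in>opens A C. \<forall>V\<in>opens A C.
        \<mu> C U D + \<mu> C V D = \<mu> C (U \<inter> V) D + \<mu> C (U \<union> V) D) \<and>
      (\<forall>F\<subseteq>opens A C. directed F \<longrightarrow> \<mu> C (\<Union>F) D = (SUP U\<in>F. \<mu> C U D)))"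


section \<open>The valuation of a state\<close>

text \<open>The regular Borel probability measure on the spectrum of \<open>D\<close> that represents the functional
  \<open>\<psi>\<close> on \<open>D\<close>, where \<open>T \<in> D\<close> corresponds to the continuous function \<open>l \<mapsto> l T\<close> under
  the Gelfand isomorphism.\<close>

definition is_riesz_measure ::
    "('h::chilbert_space op \<Rightarrow> complex) \<Rightarrow> 'h op set \<Rightarrow> ('h op \<Rightarrow> complex) measure \<Rightarrow> bool" where
  "is_riesz_measure \<psi> D M \<longleftrightarrow>
    prob_space M \<and>
    space M = gelfand_spectrum D \<and>
    sets M = sigma_sets (gelfand_spectrum D) {U. openin (gelfand_topology D) U} \<and>
    (\<forall>B\<in>sets M. measure M B = (INF U\<in>{U. openin (gelfand_topology D) U \<and> B \<subseteq> U}. measure M U)) \<and>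
    (\<forall>B\<in>sets M. measure M B = (SUP K\<in>{K. compactin (gelfand_topology D) K \<and> K \<subseteq> B}. measure M K)) \<and>
    (\<forall>T\<in>D. \<psi> T = (\<integral>l. l T \<partial>M))"

definition riesz_valuation ::
    "('h::chilbert_space op \<Rightarrow> complex) \<Rightarrow> 'h op set \<Rightarrow> ('h op \<Rightarrow> complex) set \<Rightarrow> real" where
  "riesz_valuation \<psi> D = measure (THE M. is_riesz_measure \<psi> D M)"

definition state_valuation ::
    "'h::chilbert_space op set \<Rightarrow> ('h op \<Rightarrow> complex) \<Rightarrow>
     'h op set \<Rightarrow> ('h op set \<times> ('h op \<Rightarrow> complex)) set \<Rightarrow> 'h op set \<Rightarrow> real" where
  "state_valuation A \<psi> C U = (\<lambda>D\<in>down A C. riesz_valuation \<psi> D (U `` {D}))"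

end

theory Submission
  imports Defs
begin

text \<open>
  On each context \<open>D\<close> the Gelfand transforms of the self-adjoint elements form, by Stone--Weierstrass,
  a dense subring of the continuous real functions on the spectrum. For self-adjoint \<open>Z\<close> of norm below
  \<open>1\<close> the element \<open>1 - Z\<close> is a square, so states are real and bounded on self-adjoint elements and
  form a compact convex set; a Krein--Milman argument then yields, for every self-adjoint \<open>T\<close>, a
  character \<open>l\<close> with \<open>l T \<le> \<psi> T\<close>. Hence \<open>\<psi>\<close> is monotone in the Gelfand transform and extends to a
  positive functional on the continuous functions, which the Riesz construction
  represents by a regular measure. For contexts \<open>D \<subseteq> E\<close>, a compact \<open>K\<close> in the spectrum of \<open>E\<close> and an
  open \<open>V\<close> in that of \<open>D\<close> containing the restrictions of \<open>K\<close>, a Urysohn function in \<open>D\<close> shows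
  \<open>\<mu>\<^sub>E K \<le> \<mu>\<^sub>D V\<close>. With inner regularity this single estimate gives uniqueness of the representing
  measure (\<open>D = E\<close>) and the order reversal; inner regularity also gives preservation of
  directed joins.
\<close>

section \<open>Representing measures on compact Hausdorff spaces\<close>

text \<open>The spectra are compact Hausdorff but in general not metrizable, and this shapes the
  measure theory: countable additivity says nothing about suprema over uncountable directed families
  of opens, so inner regularity by compact sets carries that step. Order reversal compares measures
  on two different spaces that are linked only by restriction of characters. The link is made
  through elements: a \<open>T\<close> in \<open>D\<close> also lies in \<open>E\<close>, its
  transform on the spectrum of \<open>E\<close> is its transform on that of \<open>D\<close>
  composed with restriction, and both integrals equal \<psi>(T). The character below a state comes
  from multiplicativity on faces. Let \<open>T\<close> be constant on a face \<open>G\<close>, and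
  let X = 1/2 + Z with Z self-adjoint and small, so that X and 1 - X are positive and \<phi> is
  nonzero on both. Then \<phi> in \<open>G\<close> is a convex combination of the states \<phi>(X
  .)/\<phi>(X) and \<phi>((1-X) .)/\<phi>(1-X). These lie in \<open>G\<close> as well, hence agree
  with \<phi> at \<open>T\<close>, that is, \<phi>(X T) = \<phi>(X) \<phi>(T).\<close>

lemma borel_measurable_continuous_map:
  assumes "continuous_map X euclidean f" "space M = topspace X" "\<And>U. openin X U \<Longrightarrow> U \<in> sets M"
  shows "f \<in> borel_measurable M"
proof (rule borel_measurableI)
  fix S :: "'b set" assume "open S"
  then have "openin X {x \<in> topspace X. f x \<in> S}"
    by (intro openin_continuous_map_preimage[OF assms(1)]) simp
  moreover have "f -` S \<inter> space M = {x \<in> topspace X. f x \<in> S}"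
    using assms(2) by auto
  ultimately show "f -` S \<inter> space M \<in> sets M" using assms(3) by simp
qed

lemma continuous_map_compact_space_bounded:
  fixes f :: "'a \<Rightarrow> 'b::real_normed_vector"
  assumes "compact_space X" "continuous_map X euclidean f"
  obtains B where "0 < B" "\<And>x. x \<in> topspace X \<Longrightarrow> norm (f x) \<le> B"
proof -
  have "compact (f ` topspace X)"
    using assms image_compactin[of X "topspace X" euclidean f] by (simp add: compact_space_def)
  then show thesis
    using that by (auto dest!: compact_imp_bounded simp: bounded_pos)
qed

lemma integrable_continuous_map:
  fixes f :: "'a \<Rightarrow> 'b::{banach, second_countable_topology}"
  assumes "compact_space X" "continuous_map X euclidean f" "finite_measure M"
    "space M = topspace X" "\<And>U. openin X U \<Longrightarrow> U \<in> sets M"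
  shows "integrable M f"
proof -
  obtain B where "\<And>x. x \<in> topspace X \<Longrightarrow> norm (f x) \<le> B"
    using continuous_map_compact_space_bounded[OF assms(1,2)] by metis
  then have "AE x in M. norm (f x) \<le> B"
    using assms(4) by auto
  with assms show ?thesis
    by (intro finite_measure.integrable_const_bound[OF assms(3)] borel_measurable_continuous_map[of X]) auto
qed

section \<open>Normalised positive functionals and the values of the measure on open sets\<close>

locale positive_functional =
  fixes X :: "'a topology" and I :: "('a \<Rightarrow> real) \<Rightarrow> real"
  assumes compact: "compact_space X"
    and Hausdorff: "Hausdorff_space X"
    and add: "\<lbrakk>continuous_map X euclideanreal f; continuous_map X euclideanreal g\<rbrakk>
      \<Longrightarrow> I (\<lambda>x. f x + g x) = I f + I g"
    and scale: "continuous_map X euclideanreal f \<Longrightarrow> I (\<lambda>x. c * f x) = c * I f"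
    and nonneg: "\<lbrakk>continuous_map X euclideanreal f; \<And>x. x \<in> topspace X \<Longrightarrow> 0 \<le> f x\<rbrakk> \<Longrightarrow> 0 \<le> I f"
    and one: "I (\<lambda>_. 1) = 1"
begin

lemma diff:
  assumes "continuous_map X euclideanreal f" "continuous_map X euclideanreal g"
  shows "I (\<lambda>x. f x - g x) = I f - I g"
proof -
  have "I (\<lambda>x. f x + (-1) * g x) = I f + (-1) * I g"
    using assms add[of f "\<lambda>x. (-1) * g x"] scale[of g "-1"]
    by (simp add: continuous_map_real_mult_left)
  then show ?thesis by simp
qed

text \<open>\<open>I\<close> takes functions on the whole type, but the comparison involves only
  points of the space. Applied in both directions this shows that \<open>I f\<close> depends only on
  the restriction of \<open>f\<close> to \<open>topspace X\<close>.\<close>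

lemma mono:
  assumes "continuous_map X euclideanreal f" "continuous_map X euclideanreal g"
    and "\<And>x. x \<in> topspace X \<Longrightarrow> f x \<le> g x"
  shows "I f \<le> I g"
proof -
  have "0 \<le> I (\<lambda>x. g x - f x)"
    using assms by (intro nonneg) (auto intro!: continuous_intros)
  then show ?thesis using diff[OF assms(2,1)] by simp
qed

lemma const: "I (\<lambda>_. c) = c"
  using scale[of "\<lambda>_. 1" c] one by simp

lemma zero: "I (\<lambda>_. 0) = 0"
  by (rule const)

text \<open>Instead of a support inside \<open>U\<close>, as in the usual Riesz construction, only
  vanishing off \<open>U\<close> is demanded. The support condition is recovered up to a small error
  by \<open>truncate\<close>.\<close>

definition dominated :: "'a set \<Rightarrow> ('a \<Rightarrow> real) set" where
  "dominated U = {f. continuous_map X euclideanreal f \<and>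
    (\<forall>x\<in>topspace X. 0 \<le> f x \<and> f x \<le> indicat_real U x)}"

lemma dominatedI:
  assumes "continuous_map X euclideanreal f"
    and "\<And>x. x \<in> topspace X \<Longrightarrow> 0 \<le> f x" "\<And>x. x \<in> topspace X \<Longrightarrow> f x \<le> 1"
    and "\<And>x. \<lbrakk>x \<in> topspace X; x \<notin> U\<rbrakk> \<Longrightarrow> f x = 0"
  shows "f \<in> dominated U"
  using assms by (auto simp: dominated_def indicator_def)

lemma dominatedD:
  assumes "f \<in> dominated U"
  shows "continuous_map X euclideanreal f"
    and "\<And>x. x \<in> topspace X \<Longrightarrow> 0 \<le> f x" "\<And>x. x \<in> topspace X \<Longrightarrow> f x \<le> 1"
    and "\<And>x. \<lbrakk>x \<in> topspace X; x \<notin> U\<rbrakk> \<Longrightarrow> f x = 0"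
proof -
  show "f x \<le> 1" if "x \<in> topspace X" for x
    using assms that by (cases "x \<in> U") (auto simp: dominated_def)
  show "f x = 0" if "x \<in> topspace X" "x \<notin> U" for x
    using assms that by (force simp: dominated_def)
qed (use assms in \<open>auto simp: dominated_def\<close>)

lemma dominated_mono: "U \<subseteq> V \<Longrightarrow> f \<in> dominated U \<Longrightarrow> f \<in> dominated V"
  by (intro dominatedI) (auto dest: dominatedD)

lemma zero_dominated: "(\<lambda>_. 0) \<in> dominated U"
  by (intro dominatedI) auto

lemma dominated_le_1: "f \<in> dominated U \<Longrightarrow> I f \<le> 1"
  using mono[of f "\<lambda>_. 1"] one by (auto dest: dominatedD)

definition content :: "'a set \<Rightarrow> real" where
  "content U = (SUP f\<in>dominated U. I f)"

lemma content_upper: "f \<in> dominated U \<Longrightarrow> I f \<le> content U"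
  unfolding content_def by (intro cSUP_upper bdd_aboveI2[where M = 1]) (auto intro: dominated_le_1)

lemma content_least: "(\<And>f. f \<in> dominated U \<Longrightarrow> I f \<le> c) \<Longrightarrow> content U \<le> c"
  unfolding content_def using zero_dominated by (intro cSUP_least) auto

lemma content_mono: "U \<subseteq> V \<Longrightarrow> content U \<le> content V"
  by (intro content_least content_upper) (rule dominated_mono)

lemma content_nonneg: "0 \<le> content U"
  using content_upper[OF zero_dominated] by (simp add: zero)

lemma content_le_1: "content U \<le> 1"
  by (intro content_least dominated_le_1)

lemma content_empty: "content {} = 0"
proof (rule antisym)
  show "content {} \<le> 0"
  proof (rule content_least)
    fix f assume f: "f \<in> dominated {}"
    then have "I f \<le> I (\<lambda>_. 0)"
      by (intro mono) (auto dest: dominatedD)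
    then show "I f \<le> 0" by (simp add: zero)
  qed
qed (rule content_nonneg)

lemma content_space: "content (topspace X) = 1"
proof (rule antisym)
  have "(\<lambda>_. 1) \<in> dominated (topspace X)"
    by (intro dominatedI) auto
  then show "1 \<le> content (topspace X)"
    using content_upper one by fastforce
qed (rule content_le_1)

text \<open>Cutting off the values below \<open>e\<close> gives a function whose support is closed and still in \<open>U\<close>.\<close>

lemma truncate:
  assumes f: "f \<in> dominated U" and e: "0 < e"
  obtains K g where "closedin X K" "K \<subseteq> U" "g \<in> dominated K" "I f \<le> I g + e"
proof
  let ?K = "{x \<in> topspace X. f x \<in> {e..}}" and ?g = "\<lambda>x. max (f x - e) 0"
  note f' = dominatedD[OF f]
  show "closedin X ?K"
    by (rule closedin_continuous_map_preimage[OF f'(1)]) simp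
  show "?K \<subseteq> U"
    using f'(4) e by force
  show g: "?g \<in> dominated ?K"
  proof (intro dominatedI)
    show "max (f x - e) 0 \<le> 1" if "x \<in> topspace X" for x
      using f'(3)[OF that] e by simp
  qed (auto intro!: continuous_intros f'(1))
  have "I f \<le> I (\<lambda>x. ?g x + e)"
    by (intro mono) (auto intro!: continuous_intros f'(1))
  also have "\<dots> = I ?g + e"
    by (subst add) (auto intro: dominatedD(1)[OF g] simp: const)
  finally show "I f \<le> I ?g + e" .
qed

lemma Urysohn:
  assumes "closedin X S" "closedin X T" "disjnt S T"
  obtains h where "continuous_map X euclideanreal h"
    "\<And>x. x \<in> topspace X \<Longrightarrow> 0 \<le> h x" "\<And>x. x \<in> topspace X \<Longrightarrow> h x \<le> 1"
    "\<And>x. x \<in> S \<Longrightarrow> h x = 0" "\<And>x. x \<in> T \<Longrightarrow> h x = (1::real)"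
proof -
  have "normal_space X"
    using compact Hausdorff by (intro compact_Hausdorff_or_regular_imp_normal_space) auto
  then obtain h where h: "continuous_map X (top_of_set {0..1}) h" "h ` S \<subseteq> {0}" "h ` T \<subseteq> {1::real}"
    using assms Urysohn_lemma[of X S T 0 1] by auto
  show thesis
  proof (rule that)
    show "continuous_map X euclideanreal h" "\<And>x. x \<in> topspace X \<Longrightarrow> 0 \<le> h x"
      "\<And>x. x \<in> topspace X \<Longrightarrow> h x \<le> 1"
      using h(1) by (auto simp: continuous_map_in_subtopology)
  qed (use h in blast)+
qed

text \<open>After truncation the function lives on a closed \<open>K\<close> inside the union. A
  Urysohn function \<open>h\<close> that is 0 on \<open>K - U\<close> and 1 on \<open>K - V\<close>
  splits it into \<open>g * h\<close>, which vanishes off \<open>U\<close>, and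
  \<open>g * (1 - h)\<close>, which vanishes off \<open>V\<close>.\<close>

lemma content_Un_le:
  assumes U: "openin X U" and V: "openin X V"
  shows "content (U \<union> V) \<le> content U + content V"
proof (rule content_least, rule field_le_epsilon)
  fix f and e :: real assume f: "f \<in> dominated (U \<union> V)" and e: "0 < e"
  obtain K g where K: "closedin X K" "K \<subseteq> U \<union> V" and g: "g \<in> dominated K" and fg: "I f \<le> I g + e"
    using truncate[OF f e] .
  note g' = dominatedD[OF g]
  have "closedin X (K - U)" "closedin X (K - V)" "disjnt (K - U) (K - V)"
    using K U V by (auto simp: closedin_diff disjnt_def)
  from Urysohn[OF this] obtain h where h: "continuous_map X euclideanreal h"
    "\<And>x. x \<in> topspace X \<Longrightarrow> 0 \<le> h x" "\<And>x. x \<in> topspace X \<Longrightarrow> h x \<le> 1"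
    "\<And>x. x \<in> K - U \<Longrightarrow> h x = 0" "\<And>x. x \<in> K - V \<Longrightarrow> h x = (1::real)"
    by metis
  have "(\<lambda>x. g x * h x) \<in> dominated U"
  proof (intro dominatedI)
    show "g x * h x = 0" if "x \<in> topspace X" "x \<notin> U" for x
      using that h(4) g'(4) by (cases "x \<in> K") auto
  qed (use g' h in \<open>auto intro!: continuous_intros mult_le_one\<close>)
  moreover have "(\<lambda>x. g x * (1 - h x)) \<in> dominated V"
  proof (intro dominatedI)
    show "g x * (1 - h x) = 0" if "x \<in> topspace X" "x \<notin> V" for x
      using that h(5) g'(4) by (cases "x \<in> K") auto
  qed (use g' h in \<open>auto intro!: continuous_intros mult_le_one\<close>)
  moreover have "I g = I (\<lambda>x. g x * h x) + I (\<lambda>x. g x * (1 - h x))"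
    by (subst add[symmetric]) (auto intro!: continuous_intros g' h simp: algebra_simps)
  ultimately show "I f \<le> content U + content V + e"
    using content_upper[of "\<lambda>x. g x * h x" U] content_upper[of "\<lambda>x. g x * (1 - h x)" V] fg by linarith
qed

lemma content_UN_le:
  assumes "finite J" "\<And>i. i \<in> J \<Longrightarrow> openin X (U i)"
  shows "content (\<Union>i\<in>J. U i) \<le> (\<Sum>i\<in>J. content (U i))"
  using assms
proof (induction J rule: finite_induct)
  case (insert j J)
  then have "content (U j \<union> (\<Union>i\<in>J. U i)) \<le> content (U j) + content (\<Union>i\<in>J. U i)"
    by (intro content_Un_le) auto
  with insert show ?case by fastforce
qed (simp add: content_empty)

text \<open>The truncated function lives on a compact \<open>K\<close>, and finitely many members of
  \<open>F\<close> cover \<open>K\<close>. Hence a bound for finite unions passes to unions of any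
  size.\<close>

lemma content_Union_le:
  assumes F: "\<And>U. U \<in> F \<Longrightarrow> openin X U"
    and c: "\<And>G. finite G \<Longrightarrow> G \<subseteq> F \<Longrightarrow> content (\<Union>G) \<le> c"
  shows "content (\<Union>F) \<le> c"
proof (rule content_least, rule field_le_epsilon)
  fix f and e :: real assume f: "f \<in> dominated (\<Union>F)" and e: "0 < e"
  obtain K g where K: "closedin X K" "K \<subseteq> \<Union>F" and g: "g \<in> dominated K" and fg: "I f \<le> I g + e"
    using truncate[OF f e] .
  have "compactin X K"
    using K compact by (simp add: closedin_compact_space)
  then obtain G where G: "finite G" "G \<subseteq> F" "K \<subseteq> \<Union>G"
    using K F by (meson compactinD)
  have "I g \<le> content (\<Union>G)"
    using g G(3) by (intro content_upper) (rule dominated_mono)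
  with c[OF G(1,2)] fg show "I f \<le> c + e" by linarith
qed

section \<open>The outer measure and Caratheodory's condition\<close>

definition outer :: "'a set \<Rightarrow> real" where
  "outer B = (INF U\<in>{U. openin X U \<and> B \<subseteq> U}. content U)"

lemma outer_lower: "openin X U \<Longrightarrow> B \<subseteq> U \<Longrightarrow> outer B \<le> content U"
  unfolding outer_def by (intro cINF_lower bdd_belowI2[where m = 0]) (auto simp: content_nonneg)

lemma outer_greatest:
  assumes "B \<subseteq> topspace X" "\<And>U. openin X U \<Longrightarrow> B \<subseteq> U \<Longrightarrow> c \<le> content U"
  shows "c \<le> outer B"
  unfolding outer_def using assms by (intro cINF_greatest) auto

lemma outer_approx:
  assumes "B \<subseteq> topspace X" "0 < e"
  obtains U where "openin X U" "B \<subseteq> U" "content U < outer B + e"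
proof -
  have "\<not> outer B + e \<le> outer B" using assms by simp
  then show thesis using outer_greatest[OF assms(1)] that by (meson not_le)
qed

lemma outer_open: "openin X U \<Longrightarrow> outer U = content U"
  by (intro antisym outer_lower outer_greatest content_mono) (auto dest: openin_subset)

lemma outer_nonneg: "B \<subseteq> topspace X \<Longrightarrow> 0 \<le> outer B"
  by (intro outer_greatest content_nonneg)

lemma outer_mono: "B \<subseteq> C \<Longrightarrow> C \<subseteq> topspace X \<Longrightarrow> outer B \<le> outer C"
  by (intro outer_greatest outer_lower) auto

text \<open>Countable subadditivity, phrased with a common bound \<open>r\<close> of the partial
  sums so that the argument stays within the reals. Each \<open>B i\<close> is enclosed in an open
  set at the cost of e/2^(i+1).\<close>

lemma outer_UN_le:
  fixes B :: "nat \<Rightarrow> 'a set"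
  assumes B: "\<And>i. B i \<subseteq> topspace X" and r: "\<And>n. (\<Sum>i<n. outer (B i)) \<le> r"
  shows "outer (\<Union>i. B i) \<le> r"
proof (rule field_le_epsilon)
  fix e :: real assume e: "0 < e"
  have "\<exists>U. openin X U \<and> B i \<subseteq> U \<and> content U < outer (B i) + e * (1/2) ^ Suc i" for i
    using outer_approx[OF B, of "e * (1/2) ^ Suc i" i] e by (metis mult_pos_pos zero_less_divide_1_iff zero_less_numeral zero_less_power)
  then obtain U where U: "\<And>i. openin X (U i)" "\<And>i. B i \<subseteq> U i"
    "\<And>i. content (U i) < outer (B i) + e * (1/2) ^ Suc i" by metis
  have geom: "(\<Sum>i<n. e * (1/2) ^ Suc i) \<le> e" for n
  proof -
    have "(\<Sum>i<n. e * (1/2) ^ Suc i) = e * (1 - (1/2) ^ n)"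
      by (induction n) (auto simp: algebra_simps)
    also have "\<dots> \<le> e * 1" using e by (intro mult_left_mono) auto
    finally show ?thesis by simp
  qed
  have "outer (\<Union>i. B i) \<le> content (\<Union>(range U))"
    using U by (intro outer_lower) (auto simp: openin_Union)
  also have "\<dots> \<le> r + e"
  proof (rule content_Union_le)
    fix G assume G: "finite G" "G \<subseteq> range U"
    then obtain J where J: "finite J" "G = U ` J" by (meson finite_subset_image)
    then obtain n where n: "J \<subseteq> {..<n}" by (meson finite_nat_iff_bounded)
    have "content (\<Union>G) \<le> content (\<Union>i<n. U i)"
      using J n by (intro content_mono) auto
    also have "\<dots> \<le> (\<Sum>i<n. content (U i))"
      using U by (intro content_UN_le) auto
    also have "\<dots> \<le> (\<Sum>i<n. outer (B i) + e * (1/2) ^ Suc i)"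
      using U(3) by (intro sum_mono less_imp_le)
    also have "\<dots> \<le> r + e"
      using r[of n] geom[of n] by (simp only: sum.distrib)
    finally show "content (\<Union>G) \<le> r + e" .
  qed (use U in auto)
  finally show "outer (\<Union>i. B i) \<le> r + e" .
qed

text \<open>Caratheodory's condition for open sets, by disjointness: if \<open>g\<close> lives on a
  closed \<open>K\<close> inside \<open>V \<inter> U\<close> and \<open>h\<close> on
  \<open>V - K\<close>, then \<open>g + h\<close> is still dominated by \<open>V\<close>. So the two
  contents add up to at most that of \<open>V\<close>, and the open set \<open>V - K\<close>
  contains \<open>V - U\<close>.\<close>

lemma outer_split_le:
  assumes U: "openin X U" and B: "B \<subseteq> topspace X"
  shows "outer (B \<inter> U) + outer (B - U) \<le> outer B"
proof (rule outer_greatest[OF B])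
  fix V assume V: "openin X V" and BV: "B \<subseteq> V"
  have "content (V \<inter> U) \<le> content V - outer (V - U)"
  proof (rule content_least, rule field_le_epsilon)
    fix f and e :: real assume f: "f \<in> dominated (V \<inter> U)" and e: "0 < e"
    obtain K g where K: "closedin X K" "K \<subseteq> V \<inter> U" and g: "g \<in> dominated K"
      and fg: "I f \<le> I g + e"
      using truncate[OF f e] .
    note g' = dominatedD[OF g]
    have "content (V - K) \<le> content V - I g"
    proof (rule content_least)
      fix h assume "h \<in> dominated (V - K)"
      note h' = dominatedD[OF this]
      have "(\<lambda>x. g x + h x) \<in> dominated V"
      proof (intro dominatedI)
        show "g x + h x \<le> 1" if "x \<in> topspace X" for x
          using g'(3,4) h'(3,4) that by (cases "x \<in> K") auto
        show "g x + h x = 0" if "x \<in> topspace X" "x \<notin> V" for x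
          using g'(4) h'(4) that K by auto
      qed (use g' h' in \<open>auto intro!: continuous_intros\<close>)
      then show "I h \<le> content V - I g"
        using content_upper add[OF g'(1) h'(1)] by fastforce
    qed
    moreover have "outer (V - U) \<le> content (V - K)"
      using V K by (intro outer_lower) (auto simp: openin_diff)
    ultimately show "I f \<le> content V - outer (V - U) + e"
      using fg by linarith
  qed
  moreover have "outer (B \<inter> U) \<le> content (V \<inter> U)"
    using U V BV by (intro outer_lower) auto
  moreover have "outer (B - U) \<le> outer (V - U)"
    using BV openin_subset[OF V] by (intro outer_mono) auto
  ultimately show "outer (B \<inter> U) + outer (B - U) \<le> content V" by linarith
qed

lemma outer_empty: "outer {} = 0"
  by (simp add: outer_open content_empty)

lemma outer_Un_le:
  assumes "B \<subseteq> topspace X" "C \<subseteq> topspace X"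
  shows "outer (B \<union> C) \<le> outer B + outer C"
proof -
  let ?A = "\<lambda>i::nat. if i = 0 then B else if i = 1 then C else {}"
  have "outer (\<Union>i. ?A i) \<le> outer B + outer C"
  proof (rule outer_UN_le)
    show "(\<Sum>i<n. outer (?A i)) \<le> outer B + outer C" for n
    proof -
      \<comment> \<open>Two more terms can only enlarge the sum, and they make the indices 0 and 1
        occur even when \<open>n < 2\<close>.\<close>
      have "(\<Sum>i<n. outer (?A i)) \<le> (\<Sum>i<n+2. outer (?A i))"
        using assms by (intro sum_mono2) (auto simp: outer_nonneg outer_empty)
      also have "\<dots> = (\<Sum>i\<in>{0,1}. outer (?A i))"
        by (intro sum.mono_neutral_right) (auto simp: outer_empty)
      finally show ?thesis by simp
    qed
  qed (use assms in auto)
  moreover have "(\<Union>i. ?A i) = B \<union> C"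
    by (auto split: if_splits)
  ultimately show ?thesis by simp
qed

section \<open>The Borel measure and its regularity\<close>

definition representing_measure :: "'a measure" where
  "representing_measure = measure_of (topspace X) {U. openin X U} (\<lambda>B. ennreal (outer B))"

lemma space_representing_measure: "space representing_measure = topspace X"
  by (simp add: representing_measure_def space_measure_of_conv)

lemma sets_representing_measure:
  "sets representing_measure = sigma_sets (topspace X) {U. openin X U}"
  unfolding representing_measure_def by (rule sets_measure_of) (auto dest: openin_subset)

text \<open>The open sets belong to the Caratheodory system of \<open>outer\<close>, a sigma-algebra
  on which \<open>outer\<close> is countably additive; so the Borel sets belong to it too, and
  \<open>measure_of\<close> keeps the prescribed values.\<close>

lemma emeasure_representing_measure:
  assumes "B \<in> sigma_sets (topspace X) {U. openin X U}"
  shows "emeasure representing_measure B = ennreal (outer B)"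
proof -
  let ?f = "\<lambda>B. ennreal (outer B)"
  interpret P: sigma_algebra "topspace X" "Pow (topspace X)"
    by (rule sigma_algebra_Pow)
  have "outer_measure_space (Pow (topspace X)) ?f"
    unfolding outer_measure_space_def
  proof (intro conjI)
    show "positive (Pow (topspace X)) ?f"
      by (simp add: positive_def outer_empty)
    show "increasing (Pow (topspace X)) ?f"
      by (auto simp: increasing_def intro!: ennreal_leI outer_mono)
    show "countably_subadditive (Pow (topspace X)) ?f"
      unfolding countably_subadditive_def
    proof (intro allI impI)
      fix A :: "nat \<Rightarrow> 'a set" assume "range A \<subseteq> Pow (topspace X)"
      then have A: "A i \<subseteq> topspace X" for i by auto
      \<comment> \<open>An infinite sum leaves nothing to show. A finite one supplies the real bound
        \<open>r\<close> that \<open>outer_UN_le\<close> expects.\<close>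
      show "?f (\<Union>i. A i) \<le> (\<Sum>i. ?f (A i))"
      proof (cases "\<Sum>i. ?f (A i)")
        case (real r)
        have "(\<Sum>i<n. outer (A i)) \<le> r" for n
        proof -
          have "ennreal (\<Sum>i<n. outer (A i)) = (\<Sum>i<n. ?f (A i))"
            using A by (simp add: outer_nonneg sum_ennreal)
          also have "\<dots> \<le> ennreal r"
            unfolding real(2)[symmetric] by (intro sum_le_suminf) auto
          finally show ?thesis using real(1) by simp
        qed
        then show ?thesis
          unfolding real(2) using A by (intro ennreal_leI outer_UN_le)
      qed simp
    qed
  qed
  then have ms: "measure_space (topspace X) (lambda_system (topspace X) (Pow (topspace X)) ?f) ?f"
    by (rule P.caratheodory_lemma)
  have "{U. openin X U} \<subseteq> lambda_system (topspace X) (Pow (topspace X)) ?f"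
  proof clarify
    fix U assume U: "openin X U"
    have "?f (B \<inter> U) + ?f (B - U) = ?f B" if B: "B \<subseteq> topspace X" for B
    proof -
      have "outer ((B \<inter> U) \<union> (B - U)) \<le> outer (B \<inter> U) + outer (B - U)"
        using B by (intro outer_Un_le) auto
      moreover have "(B \<inter> U) \<union> (B - U) = B" by auto
      ultimately have "outer (B \<inter> U) + outer (B - U) = outer B"
        using outer_split_le[OF U B] by simp
      moreover have "B \<inter> U \<subseteq> topspace X" "B - U \<subseteq> topspace X"
        using B by auto
      ultimately show ?thesis
        using outer_nonneg by (metis ennreal_plus)
    qed
    then show "U \<in> lambda_system (topspace X) (Pow (topspace X)) ?f"
      using openin_subset[OF U] by (auto simp: P.lambda_system_eq)
  qed
  then have sub: "sigma_sets (topspace X) {U. openin X U}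
      \<subseteq> lambda_system (topspace X) (Pow (topspace X)) ?f"
    using ms by (intro sigma_algebra.sigma_sets_subset) (auto simp: measure_space_def)
  show ?thesis
  proof (rule emeasure_measure_of[OF representing_measure_def])
    show "{U. openin X U} \<subseteq> Pow (topspace X)"
      by (auto dest: openin_subset)
    show "positive (sets representing_measure) ?f"
      by (simp add: positive_def outer_empty)
    show "countably_additive (sets representing_measure) ?f"
      using ms sub unfolding measure_space_def countably_additive_def sets_representing_measure
      by (meson order_trans subsetD)
  qed (use assms in \<open>simp add: sets_representing_measure\<close>)
qed

lemma measure_representing_measure:
  "B \<in> sets representing_measure \<Longrightarrow> measure representing_measure B = outer B"
  using sets.sets_into_space[of B representing_measure]
  by (simp add: measure_def emeasure_representing_measure sets_representing_measure
      space_representing_measure outer_nonneg)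

lemma open_in_sets: "openin X U \<Longrightarrow> U \<in> sets representing_measure"
  by (auto simp: sets_representing_measure)

lemma measure_open: "openin X U \<Longrightarrow> measure representing_measure U = content U"
  by (simp add: measure_representing_measure open_in_sets outer_open)

lemma prob_space_representing_measure: "prob_space representing_measure"
proof (rule prob_spaceI)
  have "topspace X \<in> sigma_sets (topspace X) {U. openin X U}"
    by (auto intro: sigma_sets_top)
  then show "emeasure representing_measure (space representing_measure) = 1"
    by (simp add: space_representing_measure emeasure_representing_measure outer_open content_space)
qed

lemma outer_regular:
  assumes "B \<in> sets representing_measure"
  shows "measure representing_measure B
    = (INF U\<in>{U. openin X U \<and> B \<subseteq> U}. measure representing_measure U)"
  using assms by (simp add: measure_representing_measure outer_def measure_open)

text \<open>Dual to the definition of \<open>outer\<close>: an open \<open>U\<close> that barely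
  exceeds the complement of \<open>B\<close> has a closed, hence compact, complement inside
  \<open>B\<close>.\<close>

lemma inner_regular:
  assumes B: "B \<in> sets representing_measure"
  shows "measure representing_measure B
    = (SUP K\<in>{K. compactin X K \<and> K \<subseteq> B}. measure representing_measure K)" (is "_ = ?S")
proof (rule antisym)
  interpret prob_space representing_measure by (rule prob_space_representing_measure)
  have bdd: "bdd_above (measure representing_measure ` {K. compactin X K \<and> K \<subseteq> B})"
    by (intro bdd_aboveI2[where M = 1]) simp
  show "?S \<le> prob B"
    using B by (intro cSUP_least) (auto intro: finite_measure_mono)
  have BX: "B \<subseteq> topspace X"
    using sets.sets_into_space[OF B] by (simp add: space_representing_measure)
  have C: "topspace X - B \<in> sets representing_measure"
    using sets.compl_sets[OF B] by (simp add: space_representing_measure)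
  show "prob B \<le> ?S"
  proof (rule field_le_epsilon)
    fix e :: real assume "0 < e"
    then obtain U where U: "openin X U" "topspace X - B \<subseteq> U" "content U < outer (topspace X - B) + e"
      using outer_approx[of "topspace X - B" e] by auto
    have "1 - prob U = prob (topspace X - U)"
      using prob_compl[OF open_in_sets[OF U(1)]] by (simp add: space_representing_measure)
    also have "\<dots> \<le> ?S"
      using U compact by (intro cSUP_upper[OF _ bdd]) (auto intro!: closedin_compact_space)
    finally have "1 - content U \<le> ?S"
      by (simp add: measure_open[OF U(1)])
    moreover have "outer (topspace X - B) = 1 - prob B"
      using prob_compl[OF B] measure_representing_measure[OF C] by (simp add: space_representing_measure)
    ultimately show "prob B \<le> ?S + e" using U(3) by simp
  qed
qed

section \<open>Integration against the representing measure\<close>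

lemma sum:
  assumes "finite J" "\<And>i. i \<in> J \<Longrightarrow> continuous_map X euclideanreal (f i)"
  shows "I (\<lambda>x. \<Sum>i\<in>J. f i x) = (\<Sum>i\<in>J. I (f i))"
  using assms
proof (induction J rule: finite_induct)
  case (insert j J)
  then have "continuous_map X euclideanreal (\<lambda>x. \<Sum>i\<in>J. f i x)"
    by (intro continuous_map_sum) auto
  with insert show ?case by (simp add: add)
qed (simp add: zero)

lemma integrable_representing_measure:
  fixes f :: "'a \<Rightarrow> 'b::{banach, second_countable_topology}"
  assumes "continuous_map X euclidean f"
  shows "integrable representing_measure f"
  using prob_space_representing_measure
  by (intro integrable_continuous_map[OF compact assms] open_in_sets)
    (auto simp: space_representing_measure prob_space_def)

text \<open>Slice \<open>f\<close> horizontally into \<open>n\<close> layers of height \<open>1 / n\<close>. Rescaled, each layer lies between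
  the indicators of two consecutive superlevel sets, so the two sides differ by at most \<open>1 / n\<close>.\<close>

lemma le_integral_unit_interval:
  assumes f: "continuous_map X euclideanreal f"
    and f01: "\<And>x. x \<in> topspace X \<Longrightarrow> 0 \<le> f x" "\<And>x. x \<in> topspace X \<Longrightarrow> f x \<le> 1"
  shows "I f \<le> (\<integral>x. f x \<partial>representing_measure)"
proof (rule field_le_epsilon)
  fix e :: real assume "0 < e"
  then obtain n :: nat where n: "0 < n" "1 / real n < e"
    by (metis nat_approx_posE zero_less_Suc)
  interpret prob_space representing_measure by (rule prob_space_representing_measure)
  define g where "g i x = min (f x) (real (Suc i) / n) - min (f x) (real i / n)" for i x
  define S where "S i = {x \<in> topspace X. f x \<in> {real i / n<..}}" for i
  have S: "openin X (S i)" for i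
    unfolding S_def by (rule openin_continuous_map_preimage[OF f]) simp
  have g: "continuous_map X euclideanreal (g i)" for i
    unfolding g_def by (intro continuous_intros f) auto
  have sum_g: "(\<Sum>i<n. g i x) = f x" if "x \<in> topspace X" for x
    using sum_lessThan_telescope[of "\<lambda>i. min (f x) (real i / n)" n] f01[OF that] n
    by (simp add: g_def)
  have "I f = I (\<lambda>x. \<Sum>i<n. g i x)"
    using sum_g by (intro antisym mono continuous_intros f g) auto
  also have "\<dots> = (\<Sum>i<n. I (g i))"
    using g by (intro sum) auto
  also have "\<dots> \<le> (\<Sum>i<n. prob (S i) / n)"
  proof (rule sum_mono)
    fix i
    have "(\<lambda>x. n * g i x) \<in> dominated (S i)"
      using n by (intro dominatedI continuous_map_real_mult_left g)
        (auto simp: g_def S_def min_def field_simps)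
    then have "I (\<lambda>x. n * g i x) \<le> prob (S i)"
      using content_upper measure_open[OF S] by metis
    then show "I (g i) \<le> prob (S i) / n"
      using n by (simp add: scale[OF g] field_simps)
  qed
  \<comment> \<open>The upper sum runs over \<open>S 0\<close>, ..., \<open>S (n-1)\<close>, the
    lower sum over \<open>S 1\<close>, ..., \<open>S n\<close>. Adding the term for
    \<open>S n\<close> lets the first be rewritten as the second plus the term for
    \<open>S 0\<close>, which is at most 1/n.\<close>
  also have "\<dots> \<le> (\<Sum>i<Suc n. prob (S i) / n)"
    by simp
  also have "\<dots> = prob (S 0) / n + (\<Sum>i<n. prob (S (Suc i)) / n)"
    by (rule sum.lessThan_Suc_shift)
  also have "(\<Sum>i<n. prob (S (Suc i)) / n) \<le> (\<Sum>i<n. \<integral>x. g i x \<partial>representing_measure)"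
  proof (rule sum_mono)
    fix i
    have "prob (S (Suc i)) = (\<integral>x. indicat_real (S (Suc i)) x \<partial>representing_measure)"
      using open_in_sets[OF S] by simp
    also have "\<dots> \<le> (\<integral>x. n * g i x \<partial>representing_measure)"
    proof (rule integral_mono)
      show "integrable representing_measure (indicat_real (S (Suc i)))"
        using open_in_sets[OF S] by (simp add: emeasure_eq_measure)
      show "integrable representing_measure (\<lambda>x. n * g i x)"
        by (intro integrable_mult_right integrable_representing_measure g)
      show "indicat_real (S (Suc i)) x \<le> n * g i x" for x
        using n by (auto simp: indicator_def S_def g_def min_def field_simps)
    qed
    also have "\<dots> = n * (\<integral>x. g i x \<partial>representing_measure)"
      by simp
    finally show "prob (S (Suc i)) / n \<le> (\<integral>x. g i x \<partial>representing_measure)"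
      using n by (simp add: field_simps)
  qed
  also have "\<dots> = (\<integral>x. (\<Sum>i<n. g i x) \<partial>representing_measure)"
    by (intro Bochner_Integration.integral_sum[symmetric] integrable_representing_measure g)
  also have "\<dots> = (\<integral>x. f x \<partial>representing_measure)"
    by (intro Bochner_Integration.integral_cong) (auto simp: sum_g space_representing_measure)
  also have "prob (S 0) / n \<le> e"
    using n prob_le_1[of "S 0"] by (smt (verit) divide_right_mono of_nat_0_le_iff)
  finally show "I f \<le> (\<integral>x. f x \<partial>representing_measure) + e"
    by simp
qed

text \<open>One inequality suffices: applied to \<open>g\<close> and to \<open>1 - g\<close> it
  bounds \<open>I g\<close> from both sides. The affine map from [-B, B] onto [0, 1] brings any
  continuous \<open>f\<close> into the range where it is available.\<close>

lemma eq_integral: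
  assumes f: "continuous_map X euclideanreal f"
  shows "I f = (\<integral>x. f x \<partial>representing_measure)"
proof -
  interpret prob_space representing_measure by (rule prob_space_representing_measure)
  obtain B where B: "0 < B" "\<And>x. x \<in> topspace X \<Longrightarrow> \<bar>f x\<bar> \<le> B"
    using continuous_map_compact_space_bounded[OF compact f] by (metis real_norm_def)
  define g where "g x = 1 / (2 * B) * (f x + B)" for x
  have g: "continuous_map X euclideanreal g"
    unfolding g_def by (intro continuous_map_real_mult_left continuous_map_add f) simp
  have g01: "0 \<le> g x" "g x \<le> 1" if "x \<in> topspace X" for x
    using B(1) B(2)[OF that] by (auto simp: g_def field_simps)
  have int_g: "integrable representing_measure g" and int_f: "integrable representing_measure f"
    by (intro integrable_representing_measure g f)+
  have "I (\<lambda>x. 1 - g x) \<le> (\<integral>x. 1 - g x \<partial>representing_measure)"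
    using g01 by (intro le_integral_unit_interval continuous_map_diff g) auto
  then have "I g \<ge> (\<integral>x. g x \<partial>representing_measure)"
    using int_g prob_space by (simp add: diff[OF _ g] const)
  then have "I g = (\<integral>x. g x \<partial>representing_measure)"
    using le_integral_unit_interval[OF g g01] by simp
  moreover have "I g = 1 / (2 * B) * (I f + B)"
    unfolding g_def using f by (subst scale) (auto intro!: continuous_map_add simp: add const)
  moreover have "(\<integral>x. g x \<partial>representing_measure) = 1 / (2 * B) * ((\<integral>x. f x \<partial>representing_measure) + B)"
    unfolding g_def using int_f prob_space by simp
  ultimately show ?thesis using B(1) by simp
qed

end

section \<open>Abelian von Neumann algebras\<close>

lemma cinner_add_left: "cinner (x + y) z = cinner x z + cinner y z"
  by (metis cinner_add_right cinner_commute complex_cnj_add)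

lemma cinner_scaleC_left: "cinner (c *\<^sub>C x) y = cnj c * cinner x y"
  by (metis cinner_commute cinner_scaleC_right complex_cnj_mult)

lemma cinner_right_eqI: "(\<And>y. cinner x y = cinner z y) \<Longrightarrow> x = z"
  by (metis Re_cinner vector_eq_rdot)

lemma blinfun_apply_scaleC_op: "scaleC_op c T x = c *\<^sub>C T x"
  by transfer simp

lemma scaleC_op_of_real: "scaleC_op (complex_of_real r) T = r *\<^sub>R T"
  by (rule blinfun_eqI) (simp add: blinfun_apply_scaleC_op scaleC_of_real blinfun.scaleR_left)

lemma scaleC_op_scaleC_op: "scaleC_op c (scaleC_op d T) = scaleC_op (c * d) T"
  by (rule blinfun_eqI) (simp add: blinfun_apply_scaleC_op scaleC_scaleC)

lemma scaleC_op_add: "scaleC_op c (S + T) = scaleC_op c S + scaleC_op c T"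
  by (rule blinfun_eqI) (simp add: blinfun_apply_scaleC_op scaleC_add_right blinfun.add_left)

lemma compose_scaleC_op_left: "scaleC_op c S o\<^sub>L T = scaleC_op c (S o\<^sub>L T)"
  by (rule blinfun_eqI) (simp add: blinfun_apply_scaleC_op)

lemma compose_scaleC_op_right:
  "S \<in> bounded_operators \<Longrightarrow> S o\<^sub>L scaleC_op c T = scaleC_op c (S o\<^sub>L T)"
  by (rule blinfun_eqI) (simp add: blinfun_apply_scaleC_op bounded_operators_def)

lemma compose_assoc: "(R o\<^sub>L S) o\<^sub>L T = R o\<^sub>L (S o\<^sub>L T)"
  by (rule blinfun_eqI) simp

lemma compose_id [simp]: "T o\<^sub>L id_blinfun = T" "id_blinfun o\<^sub>L T = T"
  by (auto intro: blinfun_eqI)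

lemmas compose_distribs =
  bounded_bilinear.add_left[OF bounded_bilinear_blinfun_compose]
  bounded_bilinear.add_right[OF bounded_bilinear_blinfun_compose]
  bounded_bilinear.diff_left[OF bounded_bilinear_blinfun_compose]
  bounded_bilinear.diff_right[OF bounded_bilinear_blinfun_compose]
  bounded_bilinear.scaleR_left[OF bounded_bilinear_blinfun_compose]
  bounded_bilinear.scaleR_right[OF bounded_bilinear_blinfun_compose]

lemma is_adjoint_unique: "is_adjoint T S \<Longrightarrow> is_adjoint T R \<Longrightarrow> S = R"
  by (intro blinfun_eqI cinner_right_eqI) (simp add: is_adjoint_def)

lemma is_adjoint_sym: "is_adjoint T S \<Longrightarrow> is_adjoint S T"
  unfolding is_adjoint_def by (metis cinner_commute)

lemma is_adjoint_id: "is_adjoint id_blinfun id_blinfun"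
  by (simp add: is_adjoint_def)

lemma is_adjoint_add: "is_adjoint S S' \<Longrightarrow> is_adjoint T T' \<Longrightarrow> is_adjoint (S + T) (S' + T')"
  by (simp add: is_adjoint_def blinfun.add_left cinner_add_left cinner_add_right)

lemma is_adjoint_scaleC_op: "is_adjoint T S \<Longrightarrow> is_adjoint (scaleC_op c T) (scaleC_op (cnj c) S)"
  by (simp add: is_adjoint_def blinfun_apply_scaleC_op cinner_scaleC_left cinner_scaleC_right)

lemma is_adjoint_scaleR: "is_adjoint T S \<Longrightarrow> is_adjoint (r *\<^sub>R T) (r *\<^sub>R S)"
  using is_adjoint_scaleC_op[of T S "complex_of_real r"] by (simp add: scaleC_op_of_real)

lemma is_adjoint_diff:
  assumes "is_adjoint S S'" "is_adjoint T T'" shows "is_adjoint (S - T) (S' - T')"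
  using is_adjoint_add[OF assms(1) is_adjoint_scaleR[OF assms(2), of "-1"]] by simp

lemma is_adjoint_compose:
  "is_adjoint S S' \<Longrightarrow> is_adjoint T T' \<Longrightarrow> is_adjoint (S o\<^sub>L T) (T' o\<^sub>L S')"
  by (simp add: is_adjoint_def)

text \<open>The imaginary part of \<open>cinner a b\<close> is minus the real inner product of
  \<open>a\<close> with \<open>\<i> *\<^sub>C b\<close>, and \<open>T\<close> commutes with
  multiplication by \<open>\<i>\<close>; so the real identity implies the complex one. Real
  conditions make it easy to see that the self-adjoint elements form a closed set.\<close>

lemma is_adjoint_iff_inner:
  assumes T: "T \<in> bounded_operators"
  shows "is_adjoint T S \<longleftrightarrow> (\<forall>x y. inner (S x) y = inner x (T y))"
proof
  assume inner: "\<forall>x y. inner (S x) y = inner x (T y)"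
  have Im: "Im (cinner a b) = - inner a (\<i> *\<^sub>C b)" for a b :: 'a
    by (simp add: Re_cinner[symmetric] cinner_scaleC_right)
  have "cinner (S x) y = cinner x (T y)" for x y
  proof (rule complex_eqI)
    show "Re (cinner (S x) y) = Re (cinner x (T y))"
      using inner by (simp add: Re_cinner)
    show "Im (cinner (S x) y) = Im (cinner x (T y))"
      using inner T by (simp add: Im bounded_operators_def)
  qed
  then show "is_adjoint T S" by (simp add: is_adjoint_def)
qed (metis is_adjoint_def Re_cinner)

text \<open>For self-adjoint \<open>T\<close> the number \<open>cinner (T x) x\<close> is real, so
  \<open>T x\<close> and \<open>i t x\<close> are orthogonal for the real inner product and
  Pythagoras applies. This is the estimate behind the reality of characters.\<close>

lemma norm_add_imaginary_le:
  fixes T :: "'h::chilbert_space op"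
  assumes T: "is_adjoint T T"
  shows "norm (T + scaleC_op (complex_of_real t * \<i>) id_blinfun) \<le> sqrt ((norm T)\<^sup>2 + t\<^sup>2)"
proof (rule norm_blinfun_bound)
  fix x :: 'h
  let ?y = "(complex_of_real t * \<i>) *\<^sub>C x"
  have "cinner (T x) x = cnj (cinner (T x) x)"
    using T by (metis is_adjoint_def cinner_commute)
  then have "Im (cinner (T x) x) = 0"
    by (metis Im_complex_of_real complex_cnj_cancel_iff complex_eq_iff cnj.simps(2) equal_neg_zero)
  then have "inner (T x) ?y = 0"
    by (simp add: Re_cinner[symmetric] cinner_scaleC_right)
  then have "(norm (T x + ?y))\<^sup>2 = (norm (T x))\<^sup>2 + (norm ?y)\<^sup>2"
    by (simp add: power2_norm_eq_inner inner_add_left inner_add_right inner_commute)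
  also have "(norm ?y)\<^sup>2 = t\<^sup>2 * (norm x)\<^sup>2"
    by (simp add: norm_scaleC norm_mult power_mult_distrib)
  also have "(norm (T x))\<^sup>2 \<le> (norm T * norm x)\<^sup>2"
    by (intro power_mono norm_blinfun) simp
  finally have "(norm (T x + ?y))\<^sup>2 \<le> ((norm T)\<^sup>2 + t\<^sup>2) * (norm x)\<^sup>2"
    by (simp add: algebra_simps power_mult_distrib)
  then have "norm (T x + ?y) \<le> sqrt (((norm T)\<^sup>2 + t\<^sup>2) * (norm x)\<^sup>2)"
    by (rule real_le_rsqrt)
  then show "norm ((T + scaleC_op (complex_of_real t * \<i>) id_blinfun) x)
      \<le> sqrt ((norm T)\<^sup>2 + t\<^sup>2) * norm x"
    by (simp add: blinfun.add_left blinfun_apply_scaleC_op real_sqrt_mult)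
qed simp

lemma closed_bounded_operators: "closed (bounded_operators :: 'h::chilbert_space op set)"
proof -
  have "closed {T :: 'h op. T (c *\<^sub>C x) = c *\<^sub>C T x}" for c and x :: 'h
    by (intro closed_Collect_eq continuous_intros bounded_linear.continuous_on[OF bounded_linear_scaleC])
  then show ?thesis
    unfolding bounded_operators_def by (intro closed_Collect_all)
qed

text \<open>Through the bicommutant condition this makes a von Neumann algebra complete in norm,
  which the two Banach fixed point arguments rely on.\<close>

lemma closed_commutant: "closed (commutant B :: 'h::chilbert_space op set)"
proof -
  have "closed {T. T o\<^sub>L S = S o\<^sub>L T}" for S :: "'h op"
    by (intro closed_Collect_eq bounded_linear.continuous_on[OF bounded_bilinear.bounded_linear_left[OF bounded_bilinear_blinfun_compose]]
        bounded_linear.continuous_on[OF bounded_bilinear.bounded_linear_right[OF bounded_bilinear_blinfun_compose]] continuous_on_id)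
  moreover have "commutant B = bounded_operators \<inter> (\<Inter>S\<in>B. {T. T o\<^sub>L S = S o\<^sub>L T})"
    by (auto simp: commutant_def)
  ultimately show ?thesis
    using closed_bounded_operators by (auto intro: closed_INT)
qed

lemma id_in_commutant: "id_blinfun \<in> commutant B"
  by (simp add: commutant_def bounded_operators_def)

lemma add_in_commutant: "S \<in> commutant B \<Longrightarrow> T \<in> commutant B \<Longrightarrow> S + T \<in> commutant B"
  by (simp add: commutant_def bounded_operators_def blinfun.add_left scaleC_add_right compose_distribs)

lemma scaleC_op_in_commutant:
  assumes "B \<subseteq> bounded_operators" "T \<in> commutant B"
  shows "scaleC_op c T \<in> commutant B"
proof -
  have "scaleC_op c T \<in> bounded_operators"
    using assms(2)
    by (simp add: commutant_def bounded_operators_def blinfun_apply_scaleC_op scaleC_scaleC mult.commute)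
  moreover have "scaleC_op c T o\<^sub>L S = S o\<^sub>L scaleC_op c T" if "S \<in> B" for S
    using assms that by (simp add: commutant_def compose_scaleC_op_left compose_scaleC_op_right subset_iff)
  ultimately show ?thesis by (simp add: commutant_def)
qed

lemma compose_in_commutant:
  assumes "S \<in> commutant B" "T \<in> commutant B"
  shows "S o\<^sub>L T \<in> commutant B"
proof -
  have "(S o\<^sub>L T) o\<^sub>L R = R o\<^sub>L (S o\<^sub>L T)" if "R \<in> B" for R
    using assms that by (simp add: commutant_def) (metis compose_assoc)
  then show ?thesis
    using assms by (simp add: commutant_def bounded_operators_def)
qed

section \<open>Algebraic operations, inverses and square roots inside an abelian von Neumann
  algebra\<close>

locale abelian_von_neumann_algebra =
  fixes D :: "'h::chilbert_space op set"
  assumes von_neumann: "von_neumann_algebra D"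
    and abelian: "abelian D"
begin

lemma bicommutant: "commutant (commutant D) = D"
  using von_neumann by (simp add: von_neumann_algebra_def)

lemma bounded: "T \<in> D \<Longrightarrow> T \<in> bounded_operators"
  using von_neumann by (auto simp: von_neumann_algebra_def)

lemma adjoint_in: "T \<in> D \<Longrightarrow> is_adjoint T S \<Longrightarrow> S \<in> D"
  using von_neumann is_adjoint_unique unfolding von_neumann_algebra_def by metis

lemma ex_adjoint: "T \<in> D \<Longrightarrow> \<exists>S\<in>D. is_adjoint T S"
  using von_neumann by (simp add: von_neumann_algebra_def)

lemma closed: "closed D"
  using closed_commutant bicommutant by metis

lemma id_in [simp]: "id_blinfun \<in> D"
  using id_in_commutant bicommutant by metis

lemma add_in: "S \<in> D \<Longrightarrow> T \<in> D \<Longrightarrow> S + T \<in> D"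
  using add_in_commutant bicommutant by metis

lemma scaleC_op_in: "T \<in> D \<Longrightarrow> scaleC_op c T \<in> D"
  using scaleC_op_in_commutant[of "commutant D" T c] bicommutant by (auto simp: commutant_def)

lemma scaleR_in: "T \<in> D \<Longrightarrow> r *\<^sub>R T \<in> D"
  using scaleC_op_in[of T "complex_of_real r"] by (simp add: scaleC_op_of_real)

lemma diff_in: "S \<in> D \<Longrightarrow> T \<in> D \<Longrightarrow> S - T \<in> D"
  using add_in[of S "(-1) *\<^sub>R T"] scaleR_in[of T "-1"] by simp

lemma compose_in: "S \<in> D \<Longrightarrow> T \<in> D \<Longrightarrow> S o\<^sub>L T \<in> D"
  using compose_in_commutant bicommutant by metis

lemma commute: "S \<in> D \<Longrightarrow> T \<in> D \<Longrightarrow> S o\<^sub>L T = T o\<^sub>L S"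
  using abelian by (simp add: abelian_def)

definition self_adjoint :: "'h op set" where
  "self_adjoint = {T \<in> D. is_adjoint T T}"

lemma self_adjointD: "T \<in> self_adjoint \<Longrightarrow> T \<in> D" "T \<in> self_adjoint \<Longrightarrow> is_adjoint T T"
  by (auto simp: self_adjoint_def)

lemma closed_self_adjoint: "closed self_adjoint"
proof -
  have "self_adjoint = D \<inter> {T :: 'h op. \<forall>x y. inner (T x) y = inner x (T y)}"
    using bounded by (auto simp: self_adjoint_def is_adjoint_iff_inner)
  moreover have "closed {T :: 'h op. \<forall>x y. inner (T x) y = inner x (T y)}"
    by (intro closed_Collect_all closed_Collect_eq continuous_intros)
  ultimately show ?thesis using closed by auto
qed

lemma id_self_adjoint [simp]: "id_blinfun \<in> self_adjoint"
  by (simp add: self_adjoint_def is_adjoint_id)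

lemma add_self_adjoint: "S \<in> self_adjoint \<Longrightarrow> T \<in> self_adjoint \<Longrightarrow> S + T \<in> self_adjoint"
  by (simp add: self_adjoint_def is_adjoint_add add_in)

lemma diff_self_adjoint: "S \<in> self_adjoint \<Longrightarrow> T \<in> self_adjoint \<Longrightarrow> S - T \<in> self_adjoint"
  by (simp add: self_adjoint_def is_adjoint_diff diff_in)

lemma scaleR_self_adjoint: "T \<in> self_adjoint \<Longrightarrow> r *\<^sub>R T \<in> self_adjoint"
  by (simp add: self_adjoint_def is_adjoint_scaleR scaleR_in)

lemma compose_self_adjoint: "S \<in> self_adjoint \<Longrightarrow> T \<in> self_adjoint \<Longrightarrow> S o\<^sub>L T \<in> self_adjoint"
  using is_adjoint_compose[of S S T T] by (simp add: self_adjoint_def compose_in commute)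

lemma cartesian_decomposition:
  assumes "T \<in> D"
  obtains X Y where "X \<in> self_adjoint" "Y \<in> self_adjoint" "T = X + scaleC_op \<i> Y"
proof -
  obtain S where S: "S \<in> D" "is_adjoint T S"
    using ex_adjoint[OF assms] by blast
  note S' = is_adjoint_sym[OF S(2)]
  let ?X = "scaleC_op (1/2) (T + S)" and ?Y = "scaleC_op (- \<i> / 2) (T - S)"
  have "is_adjoint ?X ?X"
    using is_adjoint_scaleC_op[OF is_adjoint_add[OF S(2) S'], of "1/2"] by (simp add: add.commute)
  then have X: "?X \<in> self_adjoint"
    using assms S by (simp add: self_adjoint_def scaleC_op_in add_in)
  have "is_adjoint ?Y (scaleC_op (\<i> / 2) (S - T))"
    using is_adjoint_scaleC_op[OF is_adjoint_diff[OF S(2) S'], of "- \<i> / 2"] by simp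
  moreover have "scaleC_op (\<i> / 2) (S - T) = ?Y"
  proof -
    have "S - T = scaleC_op (-1) (T - S)"
      using scaleC_op_of_real[of "-1" "T - S"] by simp
    then show ?thesis by (simp add: scaleC_op_scaleC_op)
  qed
  ultimately have Y: "?Y \<in> self_adjoint"
    using assms S by (simp add: self_adjoint_def scaleC_op_in diff_in)
  have "?X + scaleC_op \<i> ?Y = scaleC_op (1/2) ((T + S) + (T - S))"
    by (simp add: scaleC_op_scaleC_op flip: scaleC_op_add)
  also have "\<dots> = scaleC_op (1/2) (scaleC_op 2 T)"
    using scaleC_op_of_real[of 2 T] by (simp add: scaleR_2)
  also have "\<dots> = T"
    using scaleC_op_of_real[of 1 T] by (simp add: scaleC_op_scaleC_op)
  finally show thesis
    using X Y by (intro that[of ?X ?Y]) auto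
qed

text \<open>The fixed point of \<open>Y \<mapsto> 1 + T Y\<close> is the sum of the Neumann series;
  Banach's theorem on the complete set \<open>D\<close> places it in \<open>D\<close>.\<close>

lemma right_inverse_id_minus:
  assumes T: "T \<in> D" "norm T < 1"
  obtains Y where "Y \<in> D" "(id_blinfun - T) o\<^sub>L Y = id_blinfun"
proof -
  let ?f = "\<lambda>Y. id_blinfun + (T o\<^sub>L Y)"
  have "\<exists>!Y. Y \<in> D \<and> ?f Y = Y"
  proof (rule Banach_fix)
    show "complete D" using closed by (simp add: complete_eq_closed)
    show "D \<noteq> {}" using id_in by blast
    show "?f ` D \<subseteq> D" using T(1) by (auto intro!: add_in compose_in)
    show "dist (?f Y) (?f Z) \<le> norm T * dist Y Z" for Y Z
    proof -
      have "dist (?f Y) (?f Z) = norm (T o\<^sub>L (Y - Z))"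
        by (simp add: dist_norm compose_distribs)
      then show ?thesis by (simp add: norm_blinfun_compose dist_norm)
    qed
  qed (use T in auto)
  then obtain Y where "Y \<in> D" "?f Y = Y" by blast
  then show thesis
    by (intro that[of Y]) (auto simp: compose_distribs algebra_simps)
qed

text \<open>The square root is \<open>1 - Y\<close>, where \<open>Y\<close> is the fixed point of \<open>Y \<mapsto> (Z + Y\<^sup>2) / 2\<close>.\<close>

lemma square_root_id_minus:
  assumes Z: "Z \<in> self_adjoint" "norm Z < 1"
  obtains S where "S \<in> self_adjoint" "S o\<^sub>L S = id_blinfun - Z"
proof -
  \<comment> \<open>The ball of radius \<open>norm Z\<close> is invariant because
    \<open>norm Y * norm Y \<le> norm Z\<close> there, and on it the map contracts by the factor
    \<open>norm Z\<close>.\<close>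
  let ?f = "\<lambda>Y. (1/2) *\<^sub>R (Z + (Y o\<^sub>L Y))" and ?s = "self_adjoint \<inter> cball 0 (norm Z)"
  have "\<exists>!Y. Y \<in> ?s \<and> ?f Y = Y"
  proof (rule Banach_fix)
    show "complete ?s"
      using closed_self_adjoint by (auto simp: complete_eq_closed)
    show "?s \<noteq> {}" using Z(1) by auto
    show "?f ` ?s \<subseteq> ?s"
    proof (clarify, intro IntI)
      fix Y assume Y: "Y \<in> self_adjoint" "Y \<in> cball 0 (norm Z)"
      show "?f Y \<in> self_adjoint"
        using Y Z by (intro scaleR_self_adjoint add_self_adjoint compose_self_adjoint)
      have "norm (Z + (Y o\<^sub>L Y)) \<le> norm Z + norm Y * norm Y"
        by (intro norm_triangle_le add_left_mono norm_blinfun_compose)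
      also have "\<dots> \<le> norm Z + norm Z * 1"
        using Y Z by (intro add_left_mono mult_mono) auto
      finally show "?f Y \<in> cball 0 (norm Z)" by simp
    qed
    show "dist (?f Y) (?f W) \<le> norm Z * dist Y W" if "Y \<in> ?s" "W \<in> ?s" for Y W
    proof -
      \<comment> \<open>The difference of squares is written as Y(Y - W) + (Y - W)W.\<close>
      have "dist (?f Y) (?f W) = (1/2) * norm ((Y o\<^sub>L (Y - W)) + ((Y - W) o\<^sub>L W))"
        by (simp add: dist_norm compose_distribs flip: scaleR_diff_right)
      also have "\<dots> \<le> (1/2) * (norm Y * norm (Y - W) + norm (Y - W) * norm W)"
        by (intro mult_left_mono norm_triangle_le add_mono norm_blinfun_compose) simp
      also have "\<dots> \<le> (1/2) * (norm Z * norm (Y - W) + norm (Y - W) * norm Z)"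
        using that by (intro mult_left_mono add_mono mult_right_mono) auto
      finally show ?thesis by (simp add: dist_norm)
    qed
  qed (use Z in auto)
  then obtain Y where Y: "Y \<in> self_adjoint" "?f Y = Y" by blast
  have "Y + Y = Z + (Y o\<^sub>L Y)"
    by (subst (1 2) Y(2)[symmetric]) (simp flip: scaleR_left.add)
  then have "(id_blinfun - Y) o\<^sub>L (id_blinfun - Y) = id_blinfun - Z"
    by (simp add: compose_distribs algebra_simps)
  then show thesis
    using Y by (intro that) (auto intro: diff_self_adjoint)
qed

end

section \<open>States and characters\<close>

lemma norm_scaleC_op_le: "norm (scaleC_op c T) \<le> cmod c * norm T"
proof (rule norm_blinfun_bound)
  show "norm (scaleC_op c T x) \<le> cmod c * norm T * norm x" for x
    using mult_left_mono[OF norm_blinfun[of T x], of "cmod c"]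
    by (simp add: blinfun_apply_scaleC_op norm_scaleC mult.assoc)
qed simp

lemma compact_closed_subset:
  "compact K \<Longrightarrow> closed C \<Longrightarrow> C \<subseteq> K \<Longrightarrow> compact C"
  using compact_Int_closed[of K C] by (simp add: inf.absorb2)

lemma closed_Collect_const_imp: "(P \<Longrightarrow> closed {x. Q x}) \<Longrightarrow> closed {x. P \<longrightarrow> Q x}"
  by (cases P) auto

context abelian_von_neumann_algebra
begin

section \<open>Linear functionals and states\<close>

lemma functional_add:
  "linear_functional_on D \<phi> \<Longrightarrow> S \<in> D \<Longrightarrow> T \<in> D \<Longrightarrow> \<phi> (S + T) = \<phi> S + \<phi> T"
  by (simp add: linear_functional_on_def)

lemma functional_scaleC_op: "linear_functional_on D \<phi> \<Longrightarrow> T \<in> D \<Longrightarrow> \<phi> (scaleC_op c T) = c * \<phi> T"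
  by (simp add: linear_functional_on_def)

lemma functional_scaleR:
  "linear_functional_on D \<phi> \<Longrightarrow> T \<in> D \<Longrightarrow> \<phi> (r *\<^sub>R T) = complex_of_real r * \<phi> T"
  using functional_scaleC_op[of \<phi> T "complex_of_real r"] by (simp add: scaleC_op_of_real)

lemma functional_diff:
  assumes "linear_functional_on D \<phi>" "S \<in> D" "T \<in> D"
  shows "\<phi> (S - T) = \<phi> S - \<phi> T"
  using functional_add[OF assms(1,2) scaleR_in[OF assms(3), of "-1"]]
    functional_scaleR[OF assms(1,3), of "-1"] by simp

lemmas functional_simps = functional_add functional_diff functional_scaleC_op functional_scaleR

lemma state_linear: "state_on D \<phi> \<Longrightarrow> linear_functional_on D \<phi>"
  by (simp add: state_on_def)

lemma state_id: "state_on D \<phi> \<Longrightarrow> \<phi> id_blinfun = 1"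
  by (simp add: state_on_def)

lemma state_square:
  "state_on D \<phi> \<Longrightarrow> S \<in> self_adjoint \<Longrightarrow> \<phi> (S o\<^sub>L S) \<in> \<real>\<^sub>\<ge>\<^sub>0"
  by (simp add: state_on_def self_adjoint_def)

lemma state_id_minus:
  assumes \<phi>: "state_on D \<phi>" and Z: "Z \<in> self_adjoint" "norm Z < 1"
  shows "\<phi> (id_blinfun - Z) \<in> \<real>\<^sub>\<ge>\<^sub>0"
  using square_root_id_minus[OF Z] state_square[OF \<phi>] by metis

lemma state_self_adjoint:
  assumes \<phi>: "state_on D \<phi>" and Z: "Z \<in> self_adjoint"
  shows "Im (\<phi> Z) = 0" "Re (\<phi> Z) \<le> norm Z"
proof -
  note lin = state_linear[OF \<phi>]
  have *: "1 - \<phi> Z / of_real c \<in> \<real>\<^sub>\<ge>\<^sub>0" if c: "norm Z < c" for c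
  proof -
    have "0 < c" using c norm_ge_zero[of Z] by linarith
    with c have "\<phi> (id_blinfun - (1 / c) *\<^sub>R Z) \<in> \<real>\<^sub>\<ge>\<^sub>0"
      by (intro state_id_minus[OF \<phi>] scaleR_self_adjoint Z) simp
    then show ?thesis
      using Z by (simp add: functional_simps[OF lin] self_adjoint_def scaleR_in state_id[OF \<phi>])
  qed
  \<comment> \<open>The strict inequality \<open>norm Z < c\<close> is needed, so some
    \<open>c\<close> above \<open>norm Z\<close> is taken; the sharp bound then follows by letting
    \<open>c\<close> decrease to \<open>norm Z\<close>.\<close>
  have "0 < norm Z + 1" by (simp add: add_nonneg_pos)
  then show "Im (\<phi> Z) = 0"
    using *[of "norm Z + 1"] by (simp add: complex_nonneg_Reals_iff)
  show "Re (\<phi> Z) \<le> norm Z"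
  proof (rule field_le_epsilon)
    fix e :: real assume "0 < e"
    then show "Re (\<phi> Z) \<le> norm Z + e"
      using *[of "norm Z + e"] norm_ge_zero[of Z]
      by (simp add: complex_nonneg_Reals_iff field_simps)
  qed
qed

lemma state_self_adjoint_abs:
  assumes \<phi>: "state_on D \<phi>" and Z: "Z \<in> self_adjoint"
  shows "\<bar>Re (\<phi> Z)\<bar> \<le> norm Z"
  using state_self_adjoint(2)[OF \<phi> Z] state_self_adjoint(2)[OF \<phi> scaleR_self_adjoint[OF Z, of "-1"]] Z
    functional_scaleR[OF state_linear[OF \<phi>], of Z "-1"]
  by (simp add: self_adjoint_def)

lemma state_eq_Re: "state_on D \<phi> \<Longrightarrow> Z \<in> self_adjoint \<Longrightarrow> \<phi> Z = complex_of_real (Re (\<phi> Z))"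
  by (simp add: complex_eq_iff state_self_adjoint)

section \<open>Characters are contractive, real on self-adjoint elements, and states\<close>

lemma characterD:
  assumes "l \<in> gelfand_spectrum D"
  shows "linear_functional_on D l" "\<And>S T. S \<in> D \<Longrightarrow> T \<in> D \<Longrightarrow> l (S o\<^sub>L T) = l S * l T"
    "l id_blinfun = 1" "l \<in> extensional D"
  using assms by (auto simp: gelfand_spectrum_def)

text \<open>Continuity of characters is automatic: if \<open>cmod (l T)\<close> exceeded
  \<open>norm T\<close>, then \<open>1 - T / l T\<close> would have a right inverse in
  \<open>D\<close> while \<open>l\<close> vanishes on it.\<close>

lemma character_norm_le:
  assumes l: "l \<in> gelfand_spectrum D" and T: "T \<in> D"
  shows "cmod (l T) \<le> norm T"
proof (rule ccontr)
  note l = characterD[OF l]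
  assume "\<not> cmod (l T) \<le> norm T"
  then have less: "norm T < cmod (l T)" by simp
  then have nz: "l T \<noteq> 0" by auto
  let ?T = "scaleC_op (1 / l T) T"
  have "norm ?T \<le> cmod (1 / l T) * norm T"
    by (rule norm_scaleC_op_le)
  also have "\<dots> < 1"
    using less nz by (simp add: norm_divide field_simps)
  finally obtain Y where Y: "Y \<in> D" "(id_blinfun - ?T) o\<^sub>L Y = id_blinfun"
    using right_inverse_id_minus scaleC_op_in[OF T] by metis
  have "l (id_blinfun - ?T) * l Y = 1"
    using l(2)[of "id_blinfun - ?T" Y] Y l(3) T by (simp add: diff_in scaleC_op_in)
  moreover have "l (id_blinfun - ?T) = 0"
    using T nz by (simp add: functional_simps[OF l(1)] scaleC_op_in l(3))
  ultimately show False by simp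
qed

lemma character_self_adjoint:
  assumes l: "l \<in> gelfand_spectrum D" and T: "T \<in> self_adjoint"
  shows "Im (l T) = 0"
proof (rule ccontr)
  assume b: "Im (l T) \<noteq> 0"
  note lD = characterD[OF l] and TD = self_adjointD[OF T]
  \<comment> \<open>Arens' trick: contractivity at \<open>T + i t\<close> gives (Re l T)^2 + (Im l
    T)^2 + 2 t Im(l T) \<le> (norm T)^2 for every real t. This \<open>t\<close> makes the last term
    on the left equal to (norm T)^2 + 1.\<close>
  define t where "t = ((norm T)\<^sup>2 + 1) / (2 * Im (l T))"
  let ?S = "T + scaleC_op (complex_of_real t * \<i>) id_blinfun"
  have "cmod (l ?S) \<le> norm ?S"
    using TD by (intro character_norm_le[OF l] add_in scaleC_op_in) auto
  also have "\<dots> \<le> sqrt ((norm T)\<^sup>2 + t\<^sup>2)"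
    using TD by (intro norm_add_imaginary_le)
  finally have "(cmod (l ?S))\<^sup>2 \<le> (norm T)\<^sup>2 + t\<^sup>2"
    by (metis norm_ge_zero power_mono real_sqrt_pow2 sum_power2_ge_zero)
  moreover have "l ?S = l T + complex_of_real t * \<i>"
    using TD by (simp add: functional_simps[OF lD(1)] scaleC_op_in lD(3))
  ultimately have "(Re (l T))\<^sup>2 + (Im (l T) + t)\<^sup>2 \<le> (norm T)\<^sup>2 + t\<^sup>2"
    by (simp add: cmod_power2)
  moreover have "2 * Im (l T) * t = (norm T)\<^sup>2 + 1"
    using b by (simp add: t_def)
  ultimately show False
    using zero_le_power2[of "Re (l T)"] zero_le_power2[of "Im (l T)"]
    by (simp add: power2_sum)
qed

text \<open>For T = X + i Y the value of \<open>l\<close> at the adjoint of T times T is (l X - i l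
  Y)(l X + i l Y), a sum of two real squares. This embeds the spectrum in the compact set of
  states.\<close>

lemma character_state:
  assumes l: "l \<in> gelfand_spectrum D"
  shows "state_on D l"
proof -
  note lD = characterD[OF l]
  have "l (S o\<^sub>L T) \<in> \<real>\<^sub>\<ge>\<^sub>0" if T: "T \<in> D" and S: "is_adjoint T S" for S T
  proof -
    obtain X Y where XY: "X \<in> self_adjoint" "Y \<in> self_adjoint" "T = X + scaleC_op \<i> Y"
      using cartesian_decomposition[OF T] .
    have "is_adjoint T (X + scaleC_op (cnj \<i>) Y)"
      unfolding XY(3) using XY(1,2) by (intro is_adjoint_add is_adjoint_scaleC_op self_adjointD)
    then have "S = X + scaleC_op (cnj \<i>) Y"
      using is_adjoint_unique S by blast
    moreover have "X \<in> D" "Y \<in> D" using XY by (auto simp: self_adjoint_def)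
    moreover have "S \<in> D" using adjoint_in[OF T S] .
    ultimately have "l (S o\<^sub>L T) = (l X - \<i> * l Y) * (l X + \<i> * l Y)"
      using T lD(2)[of S T] by (simp add: XY(3) functional_simps[OF lD(1)] scaleC_op_in)
    also have "\<dots> = complex_of_real ((Re (l X))\<^sup>2 + (Re (l Y))\<^sup>2)"
      using character_self_adjoint[OF l XY(1)] character_self_adjoint[OF l XY(2)]
      by (simp add: complex_eq_iff power2_eq_square)
    finally show ?thesis
      by (simp only: nonneg_Reals_of_real_iff sum_power2_ge_zero)
  qed
  with lD show ?thesis by (simp add: state_on_def)
qed

text \<open>Extensionality freezes the coordinates outside \<open>D\<close>, so that the set can be
  closed and compact in the product over all operators.\<close>

definition states :: "('h op \<Rightarrow> complex) set" where
  "states = {\<phi> \<in> extensional D. state_on D \<phi>}"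

lemma states_state: "\<phi> \<in> states \<Longrightarrow> state_on D \<phi>"
  by (simp add: states_def)

lemma closed_states: "closed states"
proof -
  have "closed {\<phi> :: 'h op \<Rightarrow> complex. \<phi> T \<in> \<real>\<^sub>\<ge>\<^sub>0}" for T
    using closed_vimage[OF closed_nonneg_Reals_complex continuous_on_product_coordinates[of T]]
    by (simp add: vimage_def)
  then have "closed {\<phi> :: 'h op \<Rightarrow> complex. (\<forall>T. T \<notin> D \<longrightarrow> \<phi> T = undefined) \<and>
      ((\<forall>S. S \<in> D \<longrightarrow> (\<forall>T. T \<in> D \<longrightarrow> \<phi> (S + T) = \<phi> S + \<phi> T)) \<and>
       (\<forall>c T. T \<in> D \<longrightarrow> \<phi> (scaleC_op c T) = c * \<phi> T)) \<and>
      (\<forall>T. T \<in> D \<longrightarrow> (\<forall>S. is_adjoint T S \<longrightarrow> \<phi> (S o\<^sub>L T) \<in> \<real>\<^sub>\<ge>\<^sub>0)) \<and>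
      \<phi> id_blinfun = 1}"
    by (intro closed_Collect_conj closed_Collect_all closed_Collect_const_imp closed_Collect_eq
        continuous_intros continuous_on_product_coordinates)
  moreover have "states = {\<phi> :: 'h op \<Rightarrow> complex. (\<forall>T. T \<notin> D \<longrightarrow> \<phi> T = undefined) \<and>
      ((\<forall>S. S \<in> D \<longrightarrow> (\<forall>T. T \<in> D \<longrightarrow> \<phi> (S + T) = \<phi> S + \<phi> T)) \<and>
       (\<forall>c T. T \<in> D \<longrightarrow> \<phi> (scaleC_op c T) = c * \<phi> T)) \<and>
      (\<forall>T. T \<in> D \<longrightarrow> (\<forall>S. is_adjoint T S \<longrightarrow> \<phi> (S o\<^sub>L T) \<in> \<real>\<^sub>\<ge>\<^sub>0)) \<and>
      \<phi> id_blinfun = 1}"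
    by (auto simp: states_def extensional_def state_on_def linear_functional_on_def)
  ultimately show ?thesis by simp
qed

text \<open>Banach-Alaoglu by Tychonoff: a coordinate in \<open>D\<close> is confined to a disc
  whose radius comes from the cartesian parts of \<open>T\<close>, a coordinate outside
  \<open>D\<close> to the single point \<open>undefined\<close>.\<close>

lemma compact_states: "compact states"
proof -
  have "\<exists>B. \<forall>\<phi>\<in>states. cmod (\<phi> T) \<le> B" if T: "T \<in> D" for T
  proof -
    obtain X Y where XY: "X \<in> self_adjoint" "Y \<in> self_adjoint" "T = X + scaleC_op \<i> Y"
      using cartesian_decomposition[OF T] .
    have "cmod (\<phi> T) \<le> norm X + norm Y" if "\<phi> \<in> states" for \<phi>
    proof -
      note \<phi> = states_state[OF that]
      have "\<phi> T = \<phi> X + \<i> * \<phi> Y"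
        using XY by (simp add: functional_simps[OF state_linear[OF \<phi>]] self_adjoint_def scaleC_op_in)
      also have "\<dots> = Complex (Re (\<phi> X)) (Re (\<phi> Y))"
        using state_self_adjoint(1)[OF \<phi>] XY by (simp add: complex_eq_iff)
      finally show ?thesis
        using cmod_le[of "\<phi> T"] state_self_adjoint_abs[OF \<phi> XY(1)] state_self_adjoint_abs[OF \<phi> XY(2)]
        by simp
    qed
    then show ?thesis by blast
  qed
  then obtain B where B: "\<And>T \<phi>. T \<in> D \<Longrightarrow> \<phi> \<in> states \<Longrightarrow> cmod (\<phi> T) \<le> B T"
    by metis
  let ?P = "\<Pi>\<^sub>E T\<in>UNIV. if T \<in> D then cball 0 (B T) else {undefined :: complex}"
  have "compactin (product_topology (\<lambda>_. euclidean) UNIV) ?P"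
    by (subst compactin_PiE) auto
  then have "compact ?P"
    by (simp add: euclidean_product_topology)
  moreover have "states \<subseteq> ?P"
    using B by (auto simp: states_def extensional_def PiE_UNIV_domain)
  ultimately show ?thesis
    by (rule compact_closed_subset[OF _ closed_states])
qed

lemma compact_gelfand_spectrum: "compact (gelfand_spectrum D)"
proof -
  have "gelfand_spectrum D =
      states \<inter> {\<phi>. \<forall>S. S \<in> D \<longrightarrow> (\<forall>T. T \<in> D \<longrightarrow> \<phi> (S o\<^sub>L T) = \<phi> S * \<phi> T)}"
    using character_state by (auto simp: states_def gelfand_spectrum_def state_on_def)
  moreover have "closed {\<phi> :: 'h op \<Rightarrow> complex.
      \<forall>S. S \<in> D \<longrightarrow> (\<forall>T. T \<in> D \<longrightarrow> \<phi> (S o\<^sub>L T) = \<phi> S * \<phi> T)}"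
    by (intro closed_Collect_all closed_Collect_const_imp closed_Collect_eq continuous_intros
        continuous_on_product_coordinates)
  ultimately show ?thesis
    using compact_states by (simp add: compact_Int_closed)
qed

section \<open>Faces of the state space and characters below a state\<close>

definition face :: "('h op \<Rightarrow> complex) set \<Rightarrow> bool" where
  "face F \<longleftrightarrow> F \<subseteq> states \<and> F \<noteq> {} \<and> closed F \<and>
    (\<forall>\<alpha>\<in>states. \<forall>\<beta>\<in>states. \<forall>t::real. 0 < t \<and> t < 1 \<and> 
      (\<lambda>T. complex_of_real t * \<alpha> T + (1 - complex_of_real t) * \<beta> T) \<in> F \<longrightarrow> \<alpha> \<in> F)"

lemma faceD1:
  assumes "face F" "\<alpha> \<in> states" "\<beta> \<in> states" "0 < t" "t < 1"
    "(\<lambda>T. complex_of_real t * \<alpha> T + (1 - complex_of_real t) * \<beta> T) \<in> F"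
  shows "\<alpha> \<in> F"
  using assms unfolding face_def by blast

text \<open>The definition speaks of the first summand only; interchanging the summands replaces
  \<open>t\<close> by \<open>1 - t\<close>.\<close>

lemma faceD2:
  assumes "face F" "\<alpha> \<in> states" "\<beta> \<in> states" "0 < t" "t < 1"
    "(\<lambda>T. complex_of_real t * \<alpha> T + (1 - complex_of_real t) * \<beta> T) \<in> F"
  shows "\<beta> \<in> F"
  using assms(2-) by (intro faceD1[OF assms(1), of \<beta> \<alpha> "1 - t"]) (auto simp: add.commute)

text \<open>A continuous function attains its minimum on the compact face. Evaluation at
  \<open>T\<close> is affine, so a proper convex combination is minimal only if both of its
  constituents are.\<close>

lemma minimizing_face:
  assumes F: "face F"
  obtains G where "face G" "G \<subseteq> F" "\<And>\<phi> \<theta>. \<phi> \<in> G \<Longrightarrow> \<theta> \<in> F \<Longrightarrow> Re (\<phi> T) \<le> Re (\<theta> T)"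
proof -
  have cont: "continuous_on A (\<lambda>\<phi>. Re (\<phi> T))" for A :: "('h op \<Rightarrow> complex) set"
    by (rule continuous_on_subset[of UNIV]) (auto intro!: continuous_intros continuous_on_product_coordinates)
  have "compact F"
    using F by (intro compact_closed_subset[OF compact_states]) (auto simp: face_def)
  then obtain \<phi>0 where \<phi>0: "\<phi>0 \<in> F" "\<And>\<theta>. \<theta> \<in> F \<Longrightarrow> Re (\<phi>0 T) \<le> Re (\<theta> T)"
    using F cont[of F] continuous_attains_inf[of F "\<lambda>\<phi>. Re (\<phi> T)"] unfolding face_def by blast
  let ?G = "F \<inter> {\<phi>. Re (\<phi> T) = Re (\<phi>0 T)}"
  have "face ?G"
    unfolding face_def
  proof (intro conjI ballI allI impI)
    show "?G \<subseteq> states" "?G \<noteq> {}"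
      using F \<phi>0 by (auto simp: face_def)
    show "closed ?G"
      using F by (intro closed_Int closed_Collect_eq cont) (auto simp: face_def)
    fix \<alpha> \<beta> and t :: real
    assume \<alpha>: "\<alpha> \<in> states" and \<beta>: "\<beta> \<in> states"
      and t: "0 < t \<and> t < 1 \<and> (\<lambda>T. complex_of_real t * \<alpha> T + (1 - complex_of_real t) * \<beta> T) \<in> ?G"
    then have "\<alpha> \<in> F" "\<beta> \<in> F"
      using faceD1[OF F \<alpha> \<beta>, of t] faceD2[OF F \<alpha> \<beta>, of t] by auto
    then have le: "Re (\<phi>0 T) \<le> Re (\<alpha> T)" "Re (\<phi>0 T) \<le> Re (\<beta> T)"
      using \<phi>0(2) by auto
    have eq: "t * Re (\<alpha> T) + (1 - t) * Re (\<beta> T) = Re (\<phi>0 T)"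
      using t by simp
    have "(1 - t) * Re (\<phi>0 T) \<le> (1 - t) * Re (\<beta> T)"
      using le t by (intro mult_left_mono) auto
    with eq have "t * Re (\<alpha> T) \<le> t * Re (\<phi>0 T)"
      by (simp add: algebra_simps)
    with t le have "Re (\<alpha> T) = Re (\<phi>0 T)" by simp
    with \<open>\<alpha> \<in> F\<close> show "\<alpha> \<in> ?G" by simp
  qed
  then show thesis
    using \<phi>0(2) by (intro that) auto
qed

text \<open>Minimising at \<open>T\<close> makes the value at \<open>T\<close> constant, and the
  constancies obtained before survive because the face only shrinks.\<close>

lemma constant_face:
  assumes "finite Y" "face F"
  shows "\<exists>G\<subseteq>F. face G \<and> (\<forall>T\<in>Y. \<forall>\<phi>\<in>G. \<forall>\<theta>\<in>G. Re (\<phi> T) = Re (\<theta> T))"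
  using assms
proof (induction Y rule: finite_induct)
  case (insert T Y)
  then obtain G where G: "G \<subseteq> F" "face G" "\<forall>T\<in>Y. \<forall>\<phi>\<in>G. \<forall>\<theta>\<in>G. Re (\<phi> T) = Re (\<theta> T)"
    by blast
  obtain H where H: "face H" "H \<subseteq> G" "\<And>\<phi> \<theta>. \<phi> \<in> H \<Longrightarrow> \<theta> \<in> G \<Longrightarrow> Re (\<phi> T) \<le> Re (\<theta> T)"
    using minimizing_face[OF G(2)] by metis
  then have "\<forall>\<phi>\<in>H. \<forall>\<theta>\<in>H. Re (\<phi> T) = Re (\<theta> T)"
    by (meson antisym subsetD)
  with G H show ?case by (intro exI[of _ H]) blast
qed auto

text \<open>\<open>X\<close> is half the square of a self-adjoint \<open>R\<close>, since
  \<open>-2 Z\<close> has norm at most 1/2. The bound 1/4 on \<open>Z\<close> also keeps \<phi>(X)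
  at least 1/4, so that dividing by it is possible.\<close>

lemma state_half_plus:
  assumes \<phi>: "state_on D \<phi>" and Z: "Z \<in> self_adjoint" "norm Z \<le> 1/4"
  defines "X \<equiv> (1/2) *\<^sub>R id_blinfun + Z"
  shows "X \<in> self_adjoint" "1/4 \<le> Re (\<phi> X)" "(\<lambda>T\<in>D. \<phi> (X o\<^sub>L T) / \<phi> X) \<in> states"
proof -
  note lin = state_linear[OF \<phi>] and id = state_id[OF \<phi>]
  have ZD: "Z \<in> D" using Z by (simp add: self_adjoint_def)
  show X: "X \<in> self_adjoint"
    unfolding X_def using Z by (intro add_self_adjoint scaleR_self_adjoint) auto
  then have XD: "X \<in> D" by (simp add: self_adjoint_def)
  have "\<phi> X = 1/2 + \<phi> Z"
    unfolding X_def using ZD by (simp add: functional_simps[OF lin] scaleR_in id)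
  then show pos: "1/4 \<le> Re (\<phi> X)"
    using state_self_adjoint_abs[OF \<phi> Z(1)] Z(2) by simp
  have nz: "\<phi> X \<noteq> 0" using pos by auto
  have "norm ((-2) *\<^sub>R Z) < 1" using Z(2) by simp
  then obtain R where R: "R \<in> self_adjoint" "R o\<^sub>L R = id_blinfun - (-2) *\<^sub>R Z"
    using square_root_id_minus scaleR_self_adjoint[OF Z(1)] by metis
  have XR: "X = (1/2) *\<^sub>R (R o\<^sub>L R)"
    unfolding R(2) X_def by (simp add: algebra_simps)
  have RD: "R \<in> D" using R by (simp add: self_adjoint_def)
  let ?\<alpha> = "\<lambda>T. \<phi> (X o\<^sub>L T) / \<phi> X"
  have "linear_functional_on D (restrict ?\<alpha> D)"
    unfolding linear_functional_on_def
    using XD bounded[OF XD]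
    by (auto simp: add_in scaleC_op_in compose_in compose_distribs compose_scaleC_op_right
        functional_simps[OF lin] add_divide_distrib)
  moreover have "restrict ?\<alpha> D (S o\<^sub>L T) \<in> \<real>\<^sub>\<ge>\<^sub>0" if T: "T \<in> D" and S: "is_adjoint T S" for S T
  proof -
    have SD: "S \<in> D" using adjoint_in[OF T S] .
    have "is_adjoint (R o\<^sub>L T) (S o\<^sub>L R)"
      using S R(1) by (intro is_adjoint_compose) (auto simp: self_adjoint_def)
    then have "\<phi> ((S o\<^sub>L R) o\<^sub>L (R o\<^sub>L T)) \<in> \<real>\<^sub>\<ge>\<^sub>0"
      using \<phi> compose_in[OF RD T] by (simp add: state_on_def)
    \<comment> \<open>Commutativity moves both factors \<open>R\<close> to the front, so \<phi>(X S
      T) is half the value of \<phi> at the adjoint of \<open>R T\<close> times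
      \<open>R T\<close>.\<close>
    moreover have "(S o\<^sub>L R) o\<^sub>L (R o\<^sub>L T) = (R o\<^sub>L R) o\<^sub>L (S o\<^sub>L T)"
      by (metis commute compose_assoc RD SD)
    moreover have "\<phi> (X o\<^sub>L (S o\<^sub>L T)) = (1/2) * \<phi> ((R o\<^sub>L R) o\<^sub>L (S o\<^sub>L T))"
      unfolding XR using RD SD T by (simp add: compose_distribs functional_simps[OF lin] compose_in)
    ultimately obtain p where p: "0 \<le> p" "\<phi> (X o\<^sub>L (S o\<^sub>L T)) = complex_of_real (p / 2)"
      by (auto elim!: nonneg_Reals_cases)
    have "\<phi> (X o\<^sub>L (S o\<^sub>L T)) / \<phi> X = complex_of_real (p / 2 / Re (\<phi> X))"
      using p(2) state_eq_Re[OF \<phi> X] by (metis of_real_divide)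
    then show ?thesis
      using SD T pos p(1) by (simp only: restrict_apply' compose_in nonneg_Reals_of_real_iff) simp
  qed
  ultimately show "restrict ?\<alpha> D \<in> states"
    using nz by (simp add: states_def state_on_def)
qed

text \<open>As X + X' = 1 for X = 1/2 + Z and X' = 1/2 - Z, the state \<phi> is the convex
  combination of \<phi>(X .)/\<phi>(X) and \<phi>(X' .)/\<phi>(X') with weights \<phi>(X) and
  \<phi>(X'). The first of them stays in the face and so has the value \<phi>(T) at
  \<open>T\<close>; subtracting the contribution of 1/2 leaves the claim.\<close>

lemma face_multiplicative_small:
  assumes G: "face G" "\<phi> \<in> G" and T: "T \<in> self_adjoint"
    and const: "\<And>\<theta>. \<theta> \<in> G \<Longrightarrow> Re (\<theta> T) = Re (\<phi> T)"
    and Z: "Z \<in> self_adjoint" "norm Z \<le> 1/4"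
  shows "\<phi> (Z o\<^sub>L T) = \<phi> Z * \<phi> T"
proof -
  have "\<phi> \<in> states" using G by (auto simp: face_def)
  then have \<phi>: "state_on D \<phi>" and ext: "\<phi> \<in> extensional D" by (auto simp: states_def)
  note lin = state_linear[OF \<phi>] and id = state_id[OF \<phi>]
  let ?X = "(1/2) *\<^sub>R id_blinfun + Z" and ?X' = "(1/2) *\<^sub>R id_blinfun + (-1) *\<^sub>R Z"
  note X = state_half_plus[OF \<phi> Z]
  have Z': "(-1) *\<^sub>R Z \<in> self_adjoint" "norm ((-1) *\<^sub>R Z) \<le> 1/4"
    using Z scaleR_self_adjoint[OF Z(1), of "-1"] by auto
  note X' = state_half_plus[OF \<phi> Z']
  have TD: "T \<in> D" and ZD: "Z \<in> D" and XD: "?X \<in> D" and X'D: "?X' \<in> D"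
    using T Z X(1) X'(1) by (auto simp: self_adjoint_def)
  let ?\<alpha> = "\<lambda>T\<in>D. \<phi> (?X o\<^sub>L T) / \<phi> ?X" and ?\<beta> = "\<lambda>T\<in>D. \<phi> (?X' o\<^sub>L T) / \<phi> ?X'"
  have sum: "\<phi> ?X + \<phi> ?X' = 1"
    using ZD by (simp add: functional_simps[OF lin] scaleR_in id)
  define t where "t = Re (\<phi> ?X)"
  have t: "\<phi> ?X = complex_of_real t" "\<phi> ?X' = 1 - complex_of_real t"
    using state_eq_Re[OF \<phi> X(1)] sum by (auto simp: t_def algebra_simps)
  have t01: "0 < t" "t < 1"
    using X(2) X'(2) unfolding t by (auto simp: t_def)
  then have nz: "complex_of_real t \<noteq> 0" "1 - complex_of_real t \<noteq> 0"
    using of_real_eq_0_iff[of "1 - t", where ?'a = complex] by auto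
  have "(\<lambda>T. t * ?\<alpha> T + (1 - t) * ?\<beta> T) = \<phi>"
  proof
    fix S show "t * ?\<alpha> S + (1 - t) * ?\<beta> S = \<phi> S"
    proof (cases "S \<in> D")
      case True
      have "\<phi> (?X o\<^sub>L S) + \<phi> (?X' o\<^sub>L S) = \<phi> ((?X o\<^sub>L S) + (?X' o\<^sub>L S))"
        using True XD X'D by (simp only: functional_simps[OF lin] compose_in)
      also have "(?X o\<^sub>L S) + (?X' o\<^sub>L S) = S"
        by (simp add: compose_distribs flip: scaleR_left.add)
      finally show ?thesis
        using True nz unfolding t by simp
    next
      \<comment> \<open>Outside \<open>D\<close> all three functions have the value
        \<open>undefined\<close>, which a combination with weights \<open>t\<close> and
        \<open>1 - t\<close> reproduces.\<close>
      case False
      then have "\<phi> S = undefined" using ext by (simp add: extensional_def)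
      with False show ?thesis by (simp add: algebra_simps)
    qed
  qed
  then have "?\<alpha> \<in> G"
    using G faceD1[OF G(1) X(3) X'(3) t01] by simp
  then have "Re (\<phi> (?X o\<^sub>L T) / \<phi> ?X) = Re (\<phi> T)"
    using const TD by fastforce
  then have "Re (\<phi> (?X o\<^sub>L T)) = t * Re (\<phi> T)"
    using t01 unfolding t by (simp add: field_simps)
  moreover have "?X o\<^sub>L T \<in> self_adjoint"
    by (rule compose_self_adjoint[OF X(1) T])
  ultimately have eq: "\<phi> (?X o\<^sub>L T) = \<phi> ?X * \<phi> T"
    unfolding t using state_self_adjoint(1)[OF \<phi>] T by (simp add: complex_eq_iff)
  have "\<phi> (?X o\<^sub>L T) = \<phi> T / 2 + \<phi> (Z o\<^sub>L T)"
    using TD ZD by (simp add: compose_distribs functional_simps[OF lin] compose_in scaleR_in)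
  moreover have "\<phi> ?X * \<phi> T = \<phi> T / 2 + \<phi> Z * \<phi> T"
    using ZD by (simp add: functional_simps[OF lin] scaleR_in id distrib_right)
  ultimately show ?thesis using eq by simp
qed

lemma face_multiplicative:
  assumes G: "face G" "\<phi> \<in> G" and T: "T \<in> self_adjoint"
    and const: "\<And>\<theta>. \<theta> \<in> G \<Longrightarrow> Re (\<theta> T) = Re (\<phi> T)"
    and Z: "Z \<in> self_adjoint"
  shows "\<phi> (Z o\<^sub>L T) = \<phi> Z * \<phi> T"
proof -
  have "\<phi> \<in> states" using G by (auto simp: face_def)
  then have lin: "linear_functional_on D \<phi>" by (simp add: states_def state_linear)
  \<comment> \<open>The scaling brings \<open>Z\<close> into the ball of radius 1/4; the
    \<open>+ 1\<close> keeps \<open>r\<close> positive when \<open>Z = 0\<close>.\<close>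
  define r where "r = 1 / (4 * (norm Z + 1))"
  have pos: "0 < norm Z + 1" by (simp add: add_nonneg_pos)
  then have r: "r > 0" by (simp add: r_def)
  have "norm (r *\<^sub>R Z) \<le> 1/4"
    using pos by (simp add: r_def field_simps)
  then have "\<phi> ((r *\<^sub>R Z) o\<^sub>L T) = \<phi> (r *\<^sub>R Z) * \<phi> T"
    using scaleR_self_adjoint[OF Z] const by (intro face_multiplicative_small[OF G T]) auto
  then show ?thesis
    using r T Z by (simp add: compose_distribs functional_simps[OF lin] compose_in self_adjointD)
qed

lemma multiplicative_if_self_adjoint:
  assumes lin: "linear_functional_on D \<phi>" and S: "S \<in> D" and T: "T \<in> D"
    and mult: "\<And>S T. S \<in> self_adjoint \<Longrightarrow> T \<in> self_adjoint \<Longrightarrow> \<phi> (S o\<^sub>L T) = \<phi> S * \<phi> T"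
  shows "\<phi> (S o\<^sub>L T) = \<phi> S * \<phi> T"
proof -
  obtain A B where AB: "A \<in> self_adjoint" "B \<in> self_adjoint" "S = A + scaleC_op \<i> B"
    using cartesian_decomposition[OF S] .
  obtain C E where CE: "C \<in> self_adjoint" "E \<in> self_adjoint" "T = C + scaleC_op \<i> E"
    using cartesian_decomposition[OF T] .
  have D: "A \<in> D" "B \<in> D" "C \<in> D" "E \<in> D"
    using AB CE by (auto simp: self_adjoint_def)
  have "S o\<^sub>L T = ((A o\<^sub>L C) + scaleC_op \<i> (B o\<^sub>L C)) + (scaleC_op \<i> (A o\<^sub>L E) + scaleC_op (-1) (B o\<^sub>L E))"
    using D by (simp add: AB(3) CE(3) compose_distribs compose_scaleC_op_left compose_scaleC_op_right
        bounded scaleC_op_scaleC_op scaleC_op_add)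
  then have "\<phi> (S o\<^sub>L T) = (\<phi> A * \<phi> C + \<i> * (\<phi> B * \<phi> C)) + (\<i> * (\<phi> A * \<phi> E) - \<phi> B * \<phi> E)"
    using D AB(1,2) CE(1,2)
    by (simp add: functional_simps[OF lin] compose_in scaleC_op_in add_in mult)
  also have "\<dots> = \<phi> S * \<phi> T"
    using D by (simp add: AB(3) CE(3) functional_simps[OF lin] scaleC_op_in algebra_simps)
  finally show ?thesis .
qed

text \<open>A Krein--Milman argument without extreme points: every finite set of multiplicativity
  conditions is satisfied on some face of states, hence by compactness all of them are
  satisfied simultaneously.\<close>

lemma character_below_state:
  assumes \<phi>: "state_on D \<phi>" and T: "T \<in> D"
  obtains l where "l \<in> gelfand_spectrum D" "Re (l T) \<le> Re (\<phi> T)"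
proof -
  have "restrict \<phi> D \<in> states"
    using \<phi> adjoint_in
    by (auto simp: states_def state_on_def linear_functional_on_def add_in scaleC_op_in compose_in)
  moreover from this have "face states"
    using closed_states by (auto simp: face_def)
  \<comment> \<open>Working inside the face where the value at \<open>T\<close> is minimal secures
    the inequality at \<open>T\<close> for every state found below.\<close>
  ultimately obtain F where F: "face F" "\<And>\<theta>. \<theta> \<in> F \<Longrightarrow> Re (\<theta> T) \<le> Re (\<phi> T)"
    using minimizing_face[of states T] T by (metis restrict_apply')
  define C where "C p = {\<theta> :: 'h op \<Rightarrow> complex. \<theta> (fst p o\<^sub>L snd p) = \<theta> (fst p) * \<theta> (snd p)}" for p
  have "F \<inter> \<Inter>(C ` (self_adjoint \<times> self_adjoint)) \<noteq> {}"
  proof (rule compact_imp_fip)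
    show "compact F"
      using F by (intro compact_closed_subset[OF compact_states]) (auto simp: face_def)
    show "closed A" if "A \<in> C ` (self_adjoint \<times> self_adjoint)" for A
      using that by (auto simp: C_def intro!: closed_Collect_eq continuous_intros
        continuous_on_product_coordinates)
    fix \<F> assume "finite \<F>" "\<F> \<subseteq> C ` (self_adjoint \<times> self_adjoint)"
    then obtain P where P: "finite P" "P \<subseteq> self_adjoint \<times> self_adjoint" "\<F> = C ` P"
      by (meson finite_subset_image)
    \<comment> \<open>Constancy is arranged only for the second factors; the first factor may be any
      self-adjoint element in \<open>face_multiplicative\<close>.\<close>
    then obtain G where G: "G \<subseteq> F" "face G"
      "\<forall>T\<in>snd ` P. \<forall>\<theta>\<in>G. \<forall>\<phi>\<in>G. Re (\<theta> T) = Re (\<phi> T)"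
      using constant_face[of "snd ` P" F] F(1) by blast
    obtain \<theta> where \<theta>: "\<theta> \<in> G" using G(2) by (auto simp: face_def)
    have "\<theta> \<in> C p" if "p \<in> P" for p
      unfolding C_def mem_Collect_eq
    proof (rule face_multiplicative[OF G(2) \<theta>])
      show "snd p \<in> self_adjoint" "fst p \<in> self_adjoint" using that P(2) by auto
      show "Re (\<theta>' (snd p)) = Re (\<theta> (snd p))" if "\<theta>' \<in> G" for \<theta>'
        using G(3) \<theta> that \<open>p \<in> P\<close> by blast
    qed
    then show "F \<inter> \<Inter>\<F> \<noteq> {}" using \<theta> G(1) P(3) by blast
  qed
  then obtain l where l: "l \<in> F" "\<And>S T. S \<in> self_adjoint \<Longrightarrow> T \<in> self_adjoint \<Longrightarrow> l (S o\<^sub>L T) = l S * l T"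
    by (force simp: C_def)
  then have "l \<in> states" using F(1) by (auto simp: face_def)
  then have "l \<in> gelfand_spectrum D"
    using multiplicative_if_self_adjoint[OF _ _ _ l(2)]
    by (auto simp: gelfand_spectrum_def states_def state_on_def)
  with F(2)[OF l(1)] show thesis by (rule that[rotated])
qed

end

section \<open>Gelfand transforms\<close>

lemma open_coordinate_vimage: "open W \<Longrightarrow> open ((\<lambda>f. f i) -` W)"
  by (intro open_vimage continuous_on_product_coordinates)

text \<open>The classes \<open>t0_space\<close> and \<open>t1_space\<close> have to be declared separately, since the
  library's instances of them, inherited from the metric on functions with countable domain,
  would otherwise be less general than the one of \<open>t2_space\<close>.\<close>

instance "fun" :: (type, t0_space) t0_space
proof
  fix f g :: "'a \<Rightarrow> 'b" assume "f \<noteq> g"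
  then obtain i where "f i \<noteq> g i" by blast
  then obtain U where "open U" "\<not> (f i \<in> U \<longleftrightarrow> g i \<in> U)"
    by (meson separation_t0)
  then show "\<exists>U. open U \<and> \<not> (f \<in> U \<longleftrightarrow> g \<in> U)"
    by (intro exI[of _ "(\<lambda>h. h i) -` U"]) (simp add: open_coordinate_vimage)
qed

instance "fun" :: (type, t1_space) t1_space
proof
  fix f g :: "'a \<Rightarrow> 'b" assume "f \<noteq> g"
  then obtain i where "f i \<noteq> g i" by blast
  then obtain U where "open U" "f i \<in> U" "g i \<notin> U"
    by (meson separation_t1)
  then show "\<exists>U. open U \<and> f \<in> U \<and> g \<notin> U"
    by (intro exI[of _ "(\<lambda>h. h i) -` U"]) (simp add: open_coordinate_vimage)
qed

text \<open>The Stone-Weierstrass locale and the closedness of compact sets of functionals rest on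
  this instance.\<close>

instance "fun" :: (type, t2_space) t2_space
proof
  fix f g :: "'a \<Rightarrow> 'b" assume "f \<noteq> g"
  then obtain i where "f i \<noteq> g i" by blast
  then obtain U V where "open U" "open V" "f i \<in> U" "g i \<in> V" "U \<inter> V = {}"
    using hausdorff by metis
  then show "\<exists>U V. open U \<and> open V \<and> f \<in> U \<and> g \<in> V \<and> U \<inter> V = {}"
    by (intro exI[of _ "(\<lambda>h. h i) -` U"] exI[of _ "(\<lambda>h. h i) -` V"])
      (auto simp: open_coordinate_vimage)
qed

lemma topology_eqI_continuous_map_id:
  assumes "continuous_map X Y (\<lambda>x. x)" "continuous_map Y X (\<lambda>x. x)" "topspace X = topspace Y"
  shows "Y = X"
proof -
  have "{x \<in> topspace X. x \<in> U} = U" if "openin X U \<or> openin Y U" for U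
    using that assms(3) openin_subset by fastforce
  then show ?thesis
    using openin_continuous_map_preimage[OF assms(1)] openin_continuous_map_preimage[OF assms(2)]
    by (metis assms(3) topology_eq)
qed

text \<open>The product runs over \<open>D\<close>, whereas the type of functionals carries the
  product topology over all operators. On the spectrum the coordinates outside \<open>D\<close> are
  constantly \<open>undefined\<close>, so the two induced topologies agree.\<close>

lemma gelfand_topology_eq: "gelfand_topology D = top_of_set (gelfand_spectrum D)"
proof -
  have ext: "gelfand_spectrum D \<subseteq> extensional D"
    by (auto simp: gelfand_spectrum_def)
  have "continuous_map (top_of_set (gelfand_spectrum D)) (gelfand_topology D) (\<lambda>l. l)"
    unfolding gelfand_topology_def using ext
    by (auto simp: continuous_map_in_subtopology continuous_map_componentwise
        intro!: continuous_on_subset[OF continuous_on_product_coordinates])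
  moreover have "continuous_map (gelfand_topology D) (top_of_set (gelfand_spectrum D)) (\<lambda>l. l)"
  proof -
    have "continuous_map (gelfand_topology D) euclidean (\<lambda>l. l T)" for T
    proof (cases "T \<in> D")
      case True
      then show ?thesis
        unfolding gelfand_topology_def
        by (intro continuous_map_from_subtopology continuous_map_product_projection)
    next
      case False
      then have undef: "l T = undefined" if "l \<in> topspace (gelfand_topology D)" for l
        using that ext by (auto simp: gelfand_topology_def extensional_def)
      have "continuous_map (gelfand_topology D) euclidean (\<lambda>_. undefined :: complex)"
        by simp
      then show ?thesis
        by (rule continuous_map_eq) (metis undef)
    qed
    then have "continuous_map (gelfand_topology D) (product_topology (\<lambda>_. euclidean) UNIV) (\<lambda>l. l)"
      by (simp add: continuous_map_componentwise_UNIV)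
    then show ?thesis
      by (auto simp: continuous_map_in_subtopology euclidean_product_topology gelfand_topology_def)
  qed
  moreover have "topspace (gelfand_topology D) = gelfand_spectrum D"
    using ext by (auto simp: gelfand_topology_def PiE_def)
  ultimately show ?thesis
    by (intro topology_eqI_continuous_map_id) auto
qed

lemma topspace_gelfand_topology [simp]: "topspace (gelfand_topology D) = gelfand_spectrum D"
  by (simp add: gelfand_topology_eq)

lemma compactin_gelfand_topology:
  "compactin (gelfand_topology D) K \<longleftrightarrow> compact K \<and> K \<subseteq> gelfand_spectrum D"
  by (simp add: gelfand_topology_eq compactin_subtopology)

lemma Hausdorff_gelfand_topology: "Hausdorff_space (gelfand_topology D)"
  unfolding gelfand_topology_def
  by (intro Hausdorff_space_subtopology) (simp add: Hausdorff_space_product_topology)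

lemma continuous_map_evaluation: "continuous_map (gelfand_topology D) euclidean (\<lambda>l. l T)"
  by (simp add: gelfand_topology_eq continuous_on_subset[OF continuous_on_product_coordinates])

context abelian_von_neumann_algebra
begin

lemma compact_space_gelfand_topology: "compact_space (gelfand_topology D)"
  using compact_gelfand_spectrum by (simp add: compact_space_def compactin_gelfand_topology)

lemma character_eq_Re:
  "l \<in> gelfand_spectrum D \<Longrightarrow> T \<in> self_adjoint \<Longrightarrow> l T = complex_of_real (Re (l T))"
  by (simp add: complex_eq_iff character_self_adjoint)

lemma evaluation_separates:
  assumes l: "l \<in> gelfand_spectrum D" and k: "k \<in> gelfand_spectrum D" and "l \<noteq> k"
  shows "\<exists>T\<in>self_adjoint. Re (l T) \<noteq> Re (k T)"
proof (rule ccontr)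
  assume "\<not> ?thesis"
  then have eq: "l T = k T" if "T \<in> self_adjoint" for T
    using that character_eq_Re[OF l] character_eq_Re[OF k] by metis
  have "l T = k T" if T: "T \<in> D" for T
  proof -
    obtain X Y where XY: "X \<in> self_adjoint" "Y \<in> self_adjoint" "T = X + scaleC_op \<i> Y"
      using cartesian_decomposition[OF T] .
    then show ?thesis
      using eq by (simp add: functional_simps[OF characterD(1)[OF l]]
          functional_simps[OF characterD(1)[OF k]] self_adjointD scaleC_op_in)
  qed
  then have "l = k"
    using characterD(4)[OF l] characterD(4)[OF k] by (intro extensionalityI)
  with \<open>l \<noteq> k\<close> show False ..
qed

text \<open>Values off the spectrum are left free: there functionals need not be linear or
  multiplicative, and pointwise sums and products would otherwise fall outside the set.\<close>

definition gelfand_functions :: "(('h op \<Rightarrow> complex) \<Rightarrow> real) set" where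
  "gelfand_functions = {f. \<exists>T\<in>self_adjoint. \<forall>l\<in>gelfand_spectrum D. f l = Re (l T)}"

lemma gelfand_functionsI:
  "T \<in> self_adjoint \<Longrightarrow> (\<And>l. l \<in> gelfand_spectrum D \<Longrightarrow> f l = Re (l T)) \<Longrightarrow> f \<in> gelfand_functions"
  by (auto simp: gelfand_functions_def)

lemma gelfand_functionsE:
  assumes "f \<in> gelfand_functions"
  obtains T where "T \<in> self_adjoint" "\<And>l. l \<in> gelfand_spectrum D \<Longrightarrow> f l = Re (l T)"
  using assms by (auto simp: gelfand_functions_def)

lemma function_ring_on_gelfand_functions: "function_ring_on gelfand_functions (gelfand_spectrum D)"
proof
  show "compact (gelfand_spectrum D)" by (rule compact_gelfand_spectrum)
next
  fix f assume "f \<in> gelfand_functions"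
  then obtain T where "T \<in> self_adjoint" "\<And>l. l \<in> gelfand_spectrum D \<Longrightarrow> f l = Re (l T)"
    by (auto simp: gelfand_functions_def)
  moreover have "continuous_on (gelfand_spectrum D) (\<lambda>l. Re (l T))"
    by (rule continuous_on_subset[of UNIV])
      (auto intro!: continuous_intros continuous_on_product_coordinates)
  ultimately show "continuous_on (gelfand_spectrum D) f"
    by (simp cong: continuous_on_cong)
next
  fix f g assume "f \<in> gelfand_functions" "g \<in> gelfand_functions"
  then obtain S T where S: "S \<in> self_adjoint" "\<And>l. l \<in> gelfand_spectrum D \<Longrightarrow> f l = Re (l S)"
    and T: "T \<in> self_adjoint" "\<And>l. l \<in> gelfand_spectrum D \<Longrightarrow> g l = Re (l T)"
    by (metis gelfand_functionsE)
  show "(\<lambda>l. f l + g l) \<in> gelfand_functions"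
    using S T by (intro gelfand_functionsI[OF add_self_adjoint[OF S(1) T(1)]])
      (simp add: functional_simps characterD(1) self_adjointD)
  show "(\<lambda>l. f l * g l) \<in> gelfand_functions"
    using S T by (intro gelfand_functionsI[OF compose_self_adjoint[OF S(1) T(1)]])
      (simp add: characterD(2) self_adjointD character_self_adjoint)
next
  show "(\<lambda>_. c) \<in> gelfand_functions" for c
    by (intro gelfand_functionsI[OF scaleR_self_adjoint[OF id_self_adjoint, of c]])
      (simp add: functional_simps characterD(1,3))
next
  fix l k assume "l \<in> gelfand_spectrum D" "k \<in> gelfand_spectrum D" "l \<noteq> k"
  then obtain T where "T \<in> self_adjoint" "Re (l T) \<noteq> Re (k T)"
    using evaluation_separates by blast
  then show "\<exists>f\<in>gelfand_functions. f l \<noteq> f k"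
    by (intro bexI[of _ "\<lambda>l. Re (l T)"]) (auto intro: gelfand_functionsI)
qed

sublocale gelfand: function_ring_on gelfand_functions "gelfand_spectrum D"
  by (rule function_ring_on_gelfand_functions)

section \<open>Extension of a state to the continuous functions on the spectrum\<close>

lemma state_mono:
  assumes \<phi>: "state_on D \<phi>" and S: "S \<in> self_adjoint" and T: "T \<in> self_adjoint"
    and le: "\<And>l. l \<in> gelfand_spectrum D \<Longrightarrow> Re (l S) \<le> Re (l T)"
  shows "Re (\<phi> S) \<le> Re (\<phi> T)"
proof -
  have D: "S \<in> D" "T \<in> D" using S T by (auto simp: self_adjoint_def)
  obtain l where l: "l \<in> gelfand_spectrum D" "Re (l (T - S)) \<le> Re (\<phi> (T - S))"
    using character_below_state[OF \<phi> diff_in[OF D(2,1)]] .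
  then show ?thesis
    using le[OF l(1)] D
    by (simp add: functional_simps[OF characterD(1)[OF l(1)]] functional_simps[OF state_linear[OF \<phi>]])
qed

text \<open>An explicit lower approximation in place of a limit along a chosen sequence. For
  continuous \<open>f\<close> it is the limit of Re \<phi>(T) as the transform of \<open>T\<close>
  approaches \<open>f\<close> uniformly.\<close>

definition spectral_functional :: "('h op \<Rightarrow> complex) \<Rightarrow> (('h op \<Rightarrow> complex) \<Rightarrow> real) \<Rightarrow> real" where
  "spectral_functional \<phi> f =
    (SUP T\<in>{T \<in> self_adjoint. \<forall>l\<in>gelfand_spectrum D. Re (l T) \<le> f l}. Re (\<phi> T))"

text \<open>\<open>T - e\<close> competes in the supremum, and by \<open>state_mono\<close> every
  competitor stays below \<open>T + e\<close>. The case \<open>e = 0\<close> evaluates the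
  functional exactly on transforms.\<close>

lemma spectral_functional_approx:
  assumes \<phi>: "state_on D \<phi>" and T: "T \<in> self_adjoint"
    and approx: "\<And>l. l \<in> gelfand_spectrum D \<Longrightarrow> \<bar>f l - Re (l T)\<bar> \<le> e"
  shows "\<bar>spectral_functional \<phi> f - Re (\<phi> T)\<bar> \<le> e"
proof -
  note lin = state_linear[OF \<phi>] and id = state_id[OF \<phi>]
  let ?A = "{T \<in> self_adjoint. \<forall>l\<in>gelfand_spectrum D. Re (l T) \<le> f l}"
  let ?S = "T - e *\<^sub>R id_blinfun" and ?R = "T + e *\<^sub>R id_blinfun"
  have S: "?S \<in> self_adjoint" and R: "?R \<in> self_adjoint"
    by (intro diff_self_adjoint add_self_adjoint scaleR_self_adjoint T id_self_adjoint)+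
  have hat: "Re (l ?S) = Re (l T) - e" "Re (l ?R) = Re (l T) + e" if "l \<in> gelfand_spectrum D" for l
    using T characterD(3)[OF that]
    by (simp_all add: functional_simps[OF characterD(1)[OF that]] scaleR_in self_adjointD)
  have val: "Re (\<phi> ?S) = Re (\<phi> T) - e" "Re (\<phi> ?R) = Re (\<phi> T) + e"
    using T by (simp_all add: functional_simps[OF lin] scaleR_in self_adjointD id)
  have S_mem: "?S \<in> ?A"
    using S hat approx by (fastforce simp: abs_le_iff)
  have upper: "Re (\<phi> Q) \<le> Re (\<phi> T) + e" if "Q \<in> ?A" for Q
    unfolding val(2)[symmetric]
  proof (rule state_mono[OF \<phi> _ R])
    show "Re (l Q) \<le> Re (l ?R)" if "l \<in> gelfand_spectrum D" for l
      using that \<open>Q \<in> ?A\<close> hat(2)[OF that] approx[OF that] by (force simp: abs_le_iff)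
  qed (use that in auto)
  have "Re (\<phi> ?S) \<le> spectral_functional \<phi> f"
    unfolding spectral_functional_def using upper S_mem
    by (intro cSUP_upper bdd_aboveI2) auto
  moreover have "spectral_functional \<phi> f \<le> Re (\<phi> T) + e"
    unfolding spectral_functional_def using upper S_mem by (intro cSUP_least) blast+
  ultimately show ?thesis using val by (simp add: abs_le_iff)
qed

lemma spectral_functional_evaluation:
  "state_on D \<phi> \<Longrightarrow> T \<in> self_adjoint \<Longrightarrow> spectral_functional \<phi> (\<lambda>l. Re (l T)) = Re (\<phi> T)"
  using spectral_functional_approx[of \<phi> T "\<lambda>l. Re (l T)" 0] by simp

lemma gelfand_approx:
  assumes "continuous_map (gelfand_topology D) euclideanreal f" "0 < e"
  shows "\<exists>T\<in>self_adjoint. \<forall>l\<in>gelfand_spectrum D. \<bar>f l - Re (l T)\<bar> \<le> e"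
proof -
  obtain g where g: "g \<in> gelfand_functions" "\<forall>l\<in>gelfand_spectrum D. \<bar>f l - g l\<bar> < e"
    using gelfand.Stone_Weierstrass_basic[of f e] assms by (auto simp: gelfand_topology_eq)
  then show ?thesis
    unfolding gelfand_functions_def by (fastforce intro: less_imp_le)
qed

lemma positive_functional_spectral_functional:
  assumes \<phi>: "state_on D \<phi>"
  shows "positive_functional (gelfand_topology D) (spectral_functional \<phi>)"
proof
  note lin = state_linear[OF \<phi>] and id = state_id[OF \<phi>]
  note approx = spectral_functional_approx[OF \<phi>]
  let ?J = "spectral_functional \<phi>"
  fix f assume f: "continuous_map (gelfand_topology D) euclideanreal f"
  {
    fix g assume g: "continuous_map (gelfand_topology D) euclideanreal g"
    have "\<bar>?J (\<lambda>l. f l + g l) - (?J f + ?J g)\<bar> \<le> 0 + e" if "0 < e" for e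
    proof -
      \<comment> \<open>The error e/4 of each approximation counts twice, once in the value at the
        sum and once in the separate value.\<close>
      have e: "0 < e / 4" using that by simp
      obtain S where S: "S \<in> self_adjoint" "\<And>l. l \<in> gelfand_spectrum D \<Longrightarrow> \<bar>f l - Re (l S)\<bar> \<le> e / 4"
        using gelfand_approx[OF f e] by blast
      obtain T where T: "T \<in> self_adjoint" "\<And>l. l \<in> gelfand_spectrum D \<Longrightarrow> \<bar>g l - Re (l T)\<bar> \<le> e / 4"
        using gelfand_approx[OF g e] by blast
      have "\<bar>?J (\<lambda>l. f l + g l) - Re (\<phi> (S + T))\<bar> \<le> e / 2"
      proof (rule approx[OF add_self_adjoint[OF S(1) T(1)]])
        fix l assume l: "l \<in> gelfand_spectrum D"
        have "Re (l (S + T)) = Re (l S) + Re (l T)"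
          using S T by (simp add: functional_simps[OF characterD(1)[OF l]] self_adjointD)
        then show "\<bar>f l + g l - Re (l (S + T))\<bar> \<le> e / 2"
          using S(2)[OF l] T(2)[OF l] by linarith
      qed
      moreover have "Re (\<phi> (S + T)) = Re (\<phi> S) + Re (\<phi> T)"
        using S T by (simp add: functional_simps[OF lin] self_adjointD)
      ultimately show ?thesis
        using approx[of S f "e / 4", OF S] approx[of T g "e / 4", OF T] by linarith
    qed
    from field_le_epsilon[OF this]
    show "?J (\<lambda>l. f l + g l) = ?J f + ?J g" by simp
  }
  {
    fix c :: real
    have "\<bar>?J (\<lambda>l. c * f l) - c * ?J f\<bar> \<le> 0 + e" if "0 < e" for e
    proof -
      \<comment> \<open>The scaled error \<open>\<bar>c\<bar> * d\<close> is incurred twice and must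
        be at most e/2; the \<open>+ 1\<close> covers \<open>c = 0\<close>.\<close>
      define d where "d = e / (2 * (\<bar>c\<bar> + 1))"
      have d: "0 < d" "\<bar>c\<bar> * d \<le> e / 2"
        using that by (auto simp: d_def field_simps)
      obtain T where T: "T \<in> self_adjoint" "\<And>l. l \<in> gelfand_spectrum D \<Longrightarrow> \<bar>f l - Re (l T)\<bar> \<le> d"
        using gelfand_approx[OF f d(1)] by blast
      have scaled: "\<bar>c * x - c * y\<bar> \<le> e / 2" if "\<bar>x - y\<bar> \<le> d" for x y
        using mult_left_mono[OF that, of "\<bar>c\<bar>"] d(2) by (simp add: abs_mult right_diff_distrib flip: abs_mult)
      have "\<bar>?J (\<lambda>l. c * f l) - Re (\<phi> (c *\<^sub>R T))\<bar> \<le> e / 2"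
      proof (rule approx[OF scaleR_self_adjoint[OF T(1)]])
        fix l assume l: "l \<in> gelfand_spectrum D"
        have "Re (l (c *\<^sub>R T)) = c * Re (l T)"
          using T by (simp add: functional_simps[OF characterD(1)[OF l]] self_adjointD)
        then show "\<bar>c * f l - Re (l (c *\<^sub>R T))\<bar> \<le> e / 2"
          using scaled[OF T(2)[OF l]] by simp
      qed
      moreover have "Re (\<phi> (c *\<^sub>R T)) = c * Re (\<phi> T)"
        using T by (simp add: functional_simps[OF lin] self_adjointD)
      ultimately show ?thesis
        using scaled[OF approx[of T f d, OF T]] by linarith
    qed
    from field_le_epsilon[OF this]
    show "?J (\<lambda>l. c * f l) = c * ?J f" by simp
  }
  show "0 \<le> ?J f" if nonneg: "\<And>l. l \<in> topspace (gelfand_topology D) \<Longrightarrow> 0 \<le> f l"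
  proof (rule field_le_epsilon)
    fix e :: real assume "0 < e"
    then have e: "0 < e / 2" by simp
    obtain T where T: "T \<in> self_adjoint"
      "\<And>l. l \<in> gelfand_spectrum D \<Longrightarrow> \<bar>f l - Re (l T)\<bar> \<le> e / 2"
      using gelfand_approx[OF f e] by blast
    have TD: "T \<in> D" using T(1) by (rule self_adjointD)
    \<comment> \<open>At this character the transform of \<open>T\<close> is at least
      \<open>f l - e/2\<close>, hence at least \<open>-e/2\<close>, and it bounds Re \<phi>(T) from
      below.\<close>
    obtain l where l: "l \<in> gelfand_spectrum D" "Re (l T) \<le> Re (\<phi> T)"
      using character_below_state[OF \<phi> TD] .
    have "0 \<le> f l" using nonneg l(1) by simp
    then show "0 \<le> ?J f + e"
      using T(2)[OF l(1)] l(2) approx[of T f "e / 2", OF T] by linarith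
  qed
next
  have "spectral_functional \<phi> (\<lambda>l. 1) = Re (\<phi> id_blinfun)"
    using spectral_functional_approx[OF \<phi> id_self_adjoint, of "\<lambda>_. 1" 0] by (simp add: characterD(3))
  then show "spectral_functional \<phi> (\<lambda>_. 1) = 1"
    by (simp add: state_id[OF \<phi>])
qed (use compact_space_gelfand_topology Hausdorff_gelfand_topology in auto)

lemma ex_riesz_measure:
  assumes \<phi>: "state_on D \<phi>"
  shows "\<exists>M. is_riesz_measure \<phi> D M"
proof -
  interpret J: positive_functional "gelfand_topology D" "spectral_functional \<phi>"
    by (rule positive_functional_spectral_functional[OF \<phi>])
  let ?M = J.representing_measure
  have Re: "continuous_map (gelfand_topology D) euclideanreal (\<lambda>l. Re (l T))" for T
    using continuous_map_compose[OF continuous_map_evaluation[of D T], of euclideanreal Re]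
    by (simp add: o_def continuous_on_Re)
  have sa: "\<phi> T = (\<integral>l. complex_of_real (Re (l T)) \<partial>?M)" if T: "T \<in> self_adjoint" for T
    using state_eq_Re[OF \<phi> T] J.eq_integral[OF Re] spectral_functional_evaluation[OF \<phi> T] by simp
  have "\<phi> T = (\<integral>l. l T \<partial>?M)" if T: "T \<in> D" for T
  proof -
    obtain X Y where XY: "X \<in> self_adjoint" "Y \<in> self_adjoint" "T = X + scaleC_op \<i> Y"
      using cartesian_decomposition[OF T] .
    have int: "integrable ?M (\<lambda>l. complex_of_real (Re (l Z)))" for Z
      by (intro integrable_of_real J.integrable_representing_measure Re)
    have "(\<integral>l. l T \<partial>?M) = (\<integral>l. complex_of_real (Re (l X)) + \<i> * complex_of_real (Re (l Y)) \<partial>?M)"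
    proof (rule Bochner_Integration.integral_cong)
      fix l assume "l \<in> space ?M"
      then have l: "l \<in> gelfand_spectrum D" by (simp add: J.space_representing_measure)
      have "l T = l X + \<i> * l Y"
        using XY by (simp add: functional_simps[OF characterD(1)[OF l]] self_adjointD scaleC_op_in)
      then show "l T = complex_of_real (Re (l X)) + \<i> * complex_of_real (Re (l Y))"
        using character_eq_Re[OF l] XY by metis
    qed simp
    also have "\<dots> = \<phi> X + \<i> * \<phi> Y"
      unfolding sa[OF XY(1)] sa[OF XY(2)]
      by (subst Bochner_Integration.integral_add) (auto intro: int integrable_mult_right simp del: integral_complex_of_real)
    also have "\<dots> = \<phi> T"
      using XY by (simp add: functional_simps[OF state_linear[OF \<phi>]] self_adjointD scaleC_op_in)
    finally show ?thesis ..
  qed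
  then have "is_riesz_measure \<phi> D ?M"
    unfolding is_riesz_measure_def
    using J.prob_space_representing_measure J.space_representing_measure J.sets_representing_measure
    by (intro conjI ballI J.outer_regular J.inner_regular) simp_all
  then show ?thesis ..
qed

end

section \<open>Comparison of the measures on two contexts\<close>

lemma is_riesz_measureD:
  assumes "is_riesz_measure \<psi> D M"
  shows "prob_space M" "space M = gelfand_spectrum D"
    "sets M = sigma_sets (gelfand_spectrum D) {U. openin (gelfand_topology D) U}"
    "\<And>U. openin (gelfand_topology D) U \<Longrightarrow> U \<in> sets M"
    "\<And>B. B \<in> sets M \<Longrightarrow> measure M B = (INF U\<in>{U. openin (gelfand_topology D) U \<and> B \<subseteq> U}. measure M U)"
    "\<And>B. B \<in> sets M \<Longrightarrow> measure M B = (SUP K\<in>{K. compactin (gelfand_topology D) K \<and> K \<subseteq> B}. measure M K)"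
    "\<And>T. T \<in> D \<Longrightarrow> \<psi> T = (\<integral>l. l T \<partial>M)"
proof -
  show sets: "sets M = sigma_sets (gelfand_spectrum D) {U. openin (gelfand_topology D) U}"
    using assms by (simp only: is_riesz_measure_def)
  show "U \<in> sets M" if "openin (gelfand_topology D) U" for U
    unfolding sets using that by (intro sigma_sets.Basic) simp
qed (use assms in \<open>unfold is_riesz_measure_def, blast\<close>)+

lemma compactin_sets_riesz_measure:
  assumes M: "is_riesz_measure \<psi> D M" and K: "compactin (gelfand_topology D) K"
  shows "K \<in> sets M"
proof -
  have "closedin (gelfand_topology D) K"
    using Hausdorff_gelfand_topology K by (rule compactin_imp_closedin)
  then have "gelfand_spectrum D - K \<in> sets M" "K \<subseteq> gelfand_spectrum D"
    by (auto simp: closedin_def intro: is_riesz_measureD(4)[OF M])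
  then show ?thesis
    using sets.compl_sets[of "gelfand_spectrum D - K" M] is_riesz_measureD(2)[OF M]
    by (simp add: double_diff)
qed

lemma riesz_measure_leI:
  assumes M: "is_riesz_measure \<psi> D M" and B: "B \<in> sets M"
    and le: "\<And>K. compactin (gelfand_topology D) K \<Longrightarrow> K \<subseteq> B \<Longrightarrow> measure M K \<le> c"
  shows "measure M B \<le> c"
  unfolding is_riesz_measureD(6)[OF M B] using le by (intro cSUP_least) auto

lemma integral_Re_evaluation:
  assumes D: "abelian_von_neumann_algebra D" and M: "is_riesz_measure \<psi> D M" and T: "T \<in> D"
  shows "integrable M (\<lambda>l. Re (l T))" "(\<integral>l. Re (l T) \<partial>M) = Re (\<psi> T)"
proof -
  note M = is_riesz_measureD[OF M]
  have "integrable M (\<lambda>l. l T)"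
    using M(1,2,4) abelian_von_neumann_algebra.compact_space_gelfand_topology[OF D]
    by (intro integrable_continuous_map[OF _ continuous_map_evaluation])
      (auto simp: prob_space_def)
  then show "integrable M (\<lambda>l. Re (l T))" "(\<integral>l. Re (l T) \<partial>M) = Re (\<psi> T)"
    using M(7)[OF T] by auto
qed

lemma restrict_gelfand_spectrum:
  assumes D: "abelian_von_neumann_algebra D" and "D \<subseteq> E" and l: "l \<in> gelfand_spectrum E"
  shows "restrict l D \<in> gelfand_spectrum D"
proof -
  interpret D: abelian_von_neumann_algebra D by (rule D)
  show ?thesis
    using assms(2) l
    by (auto simp: gelfand_spectrum_def linear_functional_on_def D.add_in D.scaleC_op_in D.compose_in subset_iff)
qed

text \<open>A function in the smaller algebra that approximately separates the restrictions of \<open>K\<close> from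
  the complement of \<open>V\<close> has the same integral with respect to both measures.\<close>

lemma riesz_measure_restrict_le:
  assumes D: "abelian_von_neumann_algebra D" and E: "abelian_von_neumann_algebra E"
    and DE: "D \<subseteq> E"
    and M: "is_riesz_measure \<psi> E M" and N: "is_riesz_measure \<psi> D N"
    and K: "compactin (gelfand_topology E) K" and V: "openin (gelfand_topology D) V"
    and KV: "\<And>l. l \<in> K \<Longrightarrow> restrict l D \<in> V"
  shows "measure M K \<le> measure N V"
proof (rule field_le_epsilon)
  fix d :: real assume "0 < d"
  \<comment> \<open>The estimate will read
    \<open>(1 - e) * measure M K \<le> measure N V + e\<close>; as \<open>measure M K\<close> is at
    most 1, the total loss is \<open>2 * e\<close>. The cap 1/2 keeps \<open>e\<close> below
    1.\<close>
  define e where "e = min (1/2) (d/2)"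
  have e: "0 < e" "e < 1" "2 * e \<le> d"
    using \<open>0 < d\<close> by (auto simp: e_def)
  interpret D: abelian_von_neumann_algebra D by (rule D)
  interpret E: abelian_von_neumann_algebra E by (rule E)
  interpret M: prob_space M using M by (rule is_riesz_measureD)
  interpret N: prob_space N using N by (rule is_riesz_measureD)
  let ?r = "\<lambda>l. restrict l D"
  have K': "compact K" "K \<subseteq> gelfand_spectrum E"
    using K by (auto simp: compactin_gelfand_topology)
  have "continuous_on UNIV (\<lambda>l :: 'a op \<Rightarrow> complex. ?r l)"
  proof (rule continuous_on_coordinatewise_then_product)
    show "continuous_on UNIV (\<lambda>l :: 'a op \<Rightarrow> complex. restrict l D T)" for T
      by (cases "T \<in> D") (auto intro: continuous_on_product_coordinates)
  qed
  then have rK: "compact (?r ` K)"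
    using K'(1) by (meson compact_continuous_image continuous_on_subset subset_UNIV)
  have rK_sub: "?r ` K \<subseteq> gelfand_spectrum D"
    using K'(2) restrict_gelfand_spectrum[OF D DE] by auto
  have "closedin (gelfand_topology D) (gelfand_spectrum D - V)"
    using V by (metis closedin_diff closedin_topspace topspace_gelfand_topology)
  then have "compactin (gelfand_topology D) (gelfand_spectrum D - V)"
    by (rule closedin_compact_space[OF D.compact_space_gelfand_topology])
  then have "closed (gelfand_spectrum D - V)"
    by (simp add: compactin_gelfand_topology compact_imp_closed)
  moreover have "closed (?r ` K)"
    using rK by (rule compact_imp_closed)
  moreover have "(gelfand_spectrum D - V) \<inter> ?r ` K = {}"
    using KV by auto
  ultimately obtain f where f: "f \<in> D.gelfand_functions" "f ` gelfand_spectrum D \<subseteq> {0..1}"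
    "\<forall>x\<in>gelfand_spectrum D - V. f x < e" "\<forall>x\<in>?r ` K. f x > 1 - e"
    using D.gelfand.two[of "gelfand_spectrum D - V" "?r ` K" e] rK_sub e by auto
  then obtain T where T: "T \<in> D.self_adjoint" "\<And>l. l \<in> gelfand_spectrum D \<Longrightarrow> f l = Re (l T)"
    by (metis D.gelfand_functionsE)
  have TD: "T \<in> D" and TE: "T \<in> E" using T(1) DE by (auto simp: D.self_adjoint_def)
  \<comment> \<open>The transform of \<open>T\<close> on the larger spectrum is its transform on the
    smaller one composed with restriction, so the bounds on \<open>f\<close> transfer.\<close>
  have fE: "f (?r l) = Re (l T)" if "l \<in> gelfand_spectrum E" for l
    using T(2)[OF restrict_gelfand_spectrum[OF D DE that]] TD by simp
  have V': "V \<in> sets N" "V \<subseteq> gelfand_spectrum D"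
    using V is_riesz_measureD(4)[OF N] openin_subset[OF V] by auto
  have K_sets: "K \<in> sets M" by (rule compactin_sets_riesz_measure[OF M K])
  have "(1 - e) * measure M K = (\<integral>l. (1 - e) * indicat_real K l \<partial>M)"
    using K_sets by simp
  also have "\<dots> \<le> (\<integral>l. Re (l T) \<partial>M)"
  proof (rule integral_mono)
    show "integrable M (\<lambda>l. (1 - e) * indicat_real K l)"
      using K_sets by (simp add: M.emeasure_eq_measure)
    show "integrable M (\<lambda>l. Re (l T))"
      by (rule integral_Re_evaluation(1)[OF E M TE])
    fix l assume "l \<in> space M"
    then have l: "l \<in> gelfand_spectrum E" by (simp add: is_riesz_measureD(2)[OF M])
    have "0 \<le> f (?r l)"
      using f(2) restrict_gelfand_spectrum[OF D DE l] by auto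
    then show "(1 - e) * indicat_real K l \<le> Re (l T)"
      using f(4) fE[OF l] by (force simp: indicator_def)
  qed
  also have "\<dots> = (\<integral>l. Re (l T) \<partial>N)"
    using integral_Re_evaluation(2)[OF E M TE] integral_Re_evaluation(2)[OF D N TD] by simp
  also have "\<dots> \<le> (\<integral>l. indicat_real V l + e \<partial>N)"
  proof (rule integral_mono)
    show "integrable N (\<lambda>l. indicat_real V l + e)"
      using V' by (simp add: N.emeasure_eq_measure)
    show "integrable N (\<lambda>l. Re (l T))"
      by (rule integral_Re_evaluation(1)[OF D N TD])
    fix l assume "l \<in> space N"
    then have l: "l \<in> gelfand_spectrum D" by (simp add: is_riesz_measureD(2)[OF N])
    then have "f l \<le> 1" using f(2) by auto
    then show "Re (l T) \<le> indicat_real V l + e"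
      using f(3) T(2)[OF l] l e by (force simp: indicator_def)
  qed
  also have "\<dots> = measure N V + e"
    using V' N.prob_space by (simp add: N.emeasure_eq_measure)
  finally have "measure M K - e * measure M K \<le> measure N V + e"
    by (simp add: algebra_simps)
  moreover have "e * measure M K \<le> e * 1"
    using e by (intro mult_left_mono) auto
  ultimately show "measure M K \<le> measure N V + d" using e by linarith
qed

text \<open>The case \<open>D = E\<close> of \<open>riesz_measure_restrict_le\<close>, where
  restriction is the identity on extensional functionals. Outer regularity of \<open>N\<close>
  replaces the open \<open>V\<close> by \<open>K\<close>, inner regularity of \<open>M\<close>
  replaces \<open>K\<close> by \<open>B\<close>.\<close>

lemma riesz_measure_le:
  assumes D: "abelian_von_neumann_algebra D"
    and M: "is_riesz_measure \<psi> D M" and N: "is_riesz_measure \<psi> D N" and B: "B \<in> sets M"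
  shows "measure M B \<le> measure N B"
proof (rule riesz_measure_leI[OF M B])
  interpret D: abelian_von_neumann_algebra D by (rule D)
  interpret N: prob_space N using N by (rule is_riesz_measureD)
  fix K assume K: "compactin (gelfand_topology D) K" "K \<subseteq> B"
  have "measure M K \<le> measure N K"
    unfolding is_riesz_measureD(5)[OF N compactin_sets_riesz_measure[OF N K(1)]]
  proof (rule cINF_greatest)
    show "{U. openin (gelfand_topology D) U \<and> K \<subseteq> U} \<noteq> {}"
      using compactin_subset_topspace[OF K(1)] by blast
    fix V assume V: "V \<in> {U. openin (gelfand_topology D) U \<and> K \<subseteq> U}"
    have "restrict l D = l" if "l \<in> K" for l
      using that K(1) by (auto simp: compactin_gelfand_topology gelfand_spectrum_def extensional_restrict)
    with V show "measure M K \<le> measure N V"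
      by (intro riesz_measure_restrict_le[OF D D _ M N K(1)]) auto
  qed
  also have "measure N K \<le> measure N B"
    using B K(2) is_riesz_measureD(3)[OF M] is_riesz_measureD(3)[OF N]
    by (intro N.finite_measure_mono) auto
  finally show "measure M K \<le> measure N B" .
qed

lemma riesz_measure_unique:
  assumes D: "abelian_von_neumann_algebra D"
    and M: "is_riesz_measure \<psi> D M" and N: "is_riesz_measure \<psi> D N"
  shows "M = N"
proof (rule measure_eqI)
  interpret M: prob_space M using M by (rule is_riesz_measureD)
  interpret N: prob_space N using N by (rule is_riesz_measureD)
  show sets: "sets M = sets N"
    using is_riesz_measureD(3)[OF M] is_riesz_measureD(3)[OF N] by simp
  fix B assume "B \<in> sets M"
  then have "measure M B = measure N B"
    using riesz_measure_le[OF D M N] riesz_measure_le[OF D N M] sets by (simp add: antisym)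
  then show "emeasure M B = emeasure N B"
    by (simp add: M.emeasure_eq_measure N.emeasure_eq_measure)
qed

lemma riesz_valuation_eq:
  assumes "abelian_von_neumann_algebra D" "is_riesz_measure \<psi> D M"
  shows "riesz_valuation \<psi> D = measure M"
  unfolding riesz_valuation_def
  using assms by (subst the_equality[of _ M]) (auto intro: riesz_measure_unique)

section \<open>Directed families and slices of opens of the spectral presheaf\<close>

lemma directed_finite_upper_bound:
  assumes F: "directed F" and "finite G" "G \<subseteq> F"
  shows "\<exists>W\<in>F. \<forall>U\<in>G. U \<subseteq> W"
  using assms(2,3)
proof (induction G rule: finite_induct)
  case empty
  then show ?case using F by (auto simp: directed_def)
next
  case (insert U G)
  then obtain W where "W \<in> F" "\<forall>U\<in>G. U \<subseteq> W" by auto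
  moreover obtain X where "X \<in> F" "U \<subseteq> X" "W \<subseteq> X"
    using F insert.prems \<open>W \<in> F\<close> unfolding directed_def by blast
  ultimately show ?case by blast
qed

lemma opensE:
  assumes "U \<in> opens A C"
  obtains W where "open_in_Sigma A W" "U = W \<inter> Sigma_down A C"
  using assms by (auto simp: opens_def openin_subtopology openin_Sigma_topology)

lemma opens_slice:
  assumes U: "U \<in> opens A C" and D: "D \<in> down A C"
  shows "openin (gelfand_topology D) (U `` {D})"
proof -
  obtain W where W: "open_in_Sigma A W" "U = W \<inter> Sigma_down A C"
    using opensE[OF U] .
  have "W `` {D} \<subseteq> gelfand_spectrum D"
    using W(1) by (auto simp: open_in_Sigma_def)
  then have "U `` {D} = W `` {D}"
    using D by (auto simp: W(2) Sigma_down_def)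
  moreover have "openin (gelfand_topology D) (W `` {D})"
    using W(1) D by (simp add: open_in_Sigma_def down_def)
  ultimately show ?thesis by simp
qed

lemma opens_restrict:
  assumes U: "U \<in> opens A C" and D: "D \<in> down A C" and DE: "D \<subseteq> E"
    and l: "l \<in> U `` {E}"
  shows "restrict l D \<in> U `` {D}"
proof -
  obtain W where W: "open_in_Sigma A W" "U = W \<inter> Sigma_down A C"
    using opensE[OF U] .
  have "(D, restrict l D) \<in> W"
    using W D DE l unfolding open_in_Sigma_def down_def by blast
  moreover from this have "restrict l D \<in> gelfand_spectrum D"
    using W(1) unfolding open_in_Sigma_def by blast
  ultimately show ?thesis
    using D by (simp add: W(2) Sigma_down_def)
qed

lemma down_trans: "D \<in> down A C \<Longrightarrow> E \<in> down A D \<Longrightarrow> E \<in> down A C"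
  by (auto simp: down_def)

section \<open>The valuations of a state on all contexts\<close>

locale von_neumann_state =
  fixes A :: "'h::chilbert_space op set" and \<psi> :: "'h op \<Rightarrow> complex"
  assumes von_neumann: "von_neumann_algebra A" and state: "state_on A \<psi>"
begin

lemma context_abelian: "D \<in> contexts A \<Longrightarrow> abelian_von_neumann_algebra D"
  by (simp add: contexts_def abelian_von_neumann_algebra_def)

lemma riesz_valuation_measure:
  assumes D: "D \<in> contexts A"
  obtains M where "is_riesz_measure \<psi> D M" "riesz_valuation \<psi> D = measure M"
proof -
  interpret D: abelian_von_neumann_algebra D by (rule context_abelian[OF D])
  have "D \<subseteq> A" using D by (simp add: contexts_def)
  then have "state_on D \<psi>"
    using state by (simp add: state_on_def linear_functional_on_def subset_iff)
  then show thesis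
    using D.ex_riesz_measure riesz_valuation_eq[OF context_abelian[OF D]] that by blast
qed

text \<open>Used twice: with \<open>D = E\<close> it is monotonicity in the open set, and for two
  slices of one open of the presheaf, which restriction maps into each other, it is order reversal
  in the context.\<close>

lemma riesz_valuation_mono:
  assumes D: "D \<in> contexts A" and E: "E \<in> contexts A" and DE: "D \<subseteq> E"
    and U: "openin (gelfand_topology E) U" and V: "openin (gelfand_topology D) V"
    and UV: "\<And>l. l \<in> U \<Longrightarrow> restrict l D \<in> V"
  shows "riesz_valuation \<psi> E U \<le> riesz_valuation \<psi> D V"
proof -
  obtain M where M: "is_riesz_measure \<psi> E M" "riesz_valuation \<psi> E = measure M"
    using riesz_valuation_measure[OF E] .
  obtain N where N: "is_riesz_measure \<psi> D N" "riesz_valuation \<psi> D = measure N"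
    using riesz_valuation_measure[OF D] .
  show ?thesis
    unfolding M(2) N(2)
  proof (rule riesz_measure_leI[OF M(1)])
    show "U \<in> sets M" by (rule is_riesz_measureD(4)[OF M(1) U])
    show "measure M K \<le> measure N V" if "compactin (gelfand_topology E) K" "K \<subseteq> U" for K
      using that UV
      by (intro riesz_measure_restrict_le[OF context_abelian[OF D] context_abelian[OF E] DE M(1) N(1) _ V]) auto
  qed
qed

lemma riesz_valuation_bounds:
  assumes "D \<in> contexts A"
  shows "0 \<le> riesz_valuation \<psi> D B" "riesz_valuation \<psi> D B \<le> 1"
    "riesz_valuation \<psi> D {} = 0" "riesz_valuation \<psi> D (gelfand_spectrum D) = 1"
proof -
  obtain M where M: "is_riesz_measure \<psi> D M" "riesz_valuation \<psi> D = measure M"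
    using riesz_valuation_measure[OF assms] .
  interpret M: prob_space M using M(1) by (rule is_riesz_measureD)
  show "0 \<le> riesz_valuation \<psi> D B" "riesz_valuation \<psi> D B \<le> 1"
    "riesz_valuation \<psi> D {} = 0" "riesz_valuation \<psi> D (gelfand_spectrum D) = 1"
    using M.prob_space is_riesz_measureD(2)[OF M(1)] by (simp_all add: M(2))
qed

lemma riesz_valuation_modular:
  assumes D: "D \<in> contexts A"
    and U: "openin (gelfand_topology D) U" and V: "openin (gelfand_topology D) V"
  shows "riesz_valuation \<psi> D U + riesz_valuation \<psi> D V
    = riesz_valuation \<psi> D (U \<inter> V) + riesz_valuation \<psi> D (U \<union> V)"
proof -
  obtain M where M: "is_riesz_measure \<psi> D M" "riesz_valuation \<psi> D = measure M"
    using riesz_valuation_measure[OF D] .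
  interpret M: prob_space M using M(1) by (rule is_riesz_measureD)
  show ?thesis
    unfolding M(2)
    using is_riesz_measureD(4)[OF M(1) U] is_riesz_measureD(4)[OF M(1) V]
    by (simp add: measure_Un3 M.fmeasurable_eq_sets)
qed

text \<open>A compact \<open>K\<close> inside the union is covered by finitely many slices, hence by
  the slice of a single member \<open>W\<close> of the directed family. Inner regularity passes from
  such \<open>K\<close> to the whole union, whatever the cardinality of \<open>F\<close>.\<close>

lemma riesz_valuation_directed_Union:
  assumes F: "F \<subseteq> opens A C" "directed F" and D: "D \<in> down A C"
  shows "riesz_valuation \<psi> D (\<Union>F `` {D}) = (SUP U\<in>F. riesz_valuation \<psi> D (U `` {D}))"
proof (rule antisym)
  have DA: "D \<in> contexts A" using D by (simp add: down_def)
  obtain M where M: "is_riesz_measure \<psi> D M" "riesz_valuation \<psi> D = measure M"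
    using riesz_valuation_measure[OF DA] .
  interpret M: prob_space M using M(1) by (rule is_riesz_measureD)
  have Union: "\<Union>F `` {D} = (\<Union>U\<in>F. U `` {D})" by blast
  have slice: "openin (gelfand_topology D) (U `` {D})" if "U \<in> F" for U
    using opens_slice[of U A C D] F(1) D that by auto
  then have "openin (gelfand_topology D) (\<Union>F `` {D})"
    unfolding Union by auto
  then have sets: "\<Union>F `` {D} \<in> sets M" by (rule is_riesz_measureD(4)[OF M(1)])
  have bdd: "bdd_above ((\<lambda>U. measure M (U `` {D})) ` F)"
    by (intro bdd_aboveI2[where M = 1]) simp
  show "riesz_valuation \<psi> D (\<Union>F `` {D}) \<le> (SUP U\<in>F. riesz_valuation \<psi> D (U `` {D}))"
    unfolding M(2)
  proof (rule riesz_measure_leI[OF M(1) sets])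
    fix K assume K: "compactin (gelfand_topology D) K" "K \<subseteq> \<Union>F `` {D}"
    then obtain \<G> where \<G>: "finite \<G>" "\<G> \<subseteq> (\<lambda>U. U `` {D}) ` F" "K \<subseteq> \<Union>\<G>"
      using compactinD[of "gelfand_topology D" K "(\<lambda>U. U `` {D}) ` F"] slice unfolding Union by auto
    obtain G where G: "G \<subseteq> F" "finite G" "\<G> = (\<lambda>U. U `` {D}) ` G"
      using finite_subset_image[OF \<G>(1,2)] by blast
    obtain W where W: "W \<in> F" "\<forall>U\<in>G. U \<subseteq> W"
      using directed_finite_upper_bound[OF F(2) G(2,1)] by blast
    have "measure M K \<le> measure M (W `` {D})"
    proof (rule M.finite_measure_mono)
      show "K \<subseteq> W `` {D}" using \<G>(3) G(3) W(2) by blast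
      show "W `` {D} \<in> sets M" by (rule is_riesz_measureD(4)[OF M(1) slice[OF W(1)]])
    qed
    also have "\<dots> \<le> (SUP U\<in>F. measure M (U `` {D}))"
      by (rule cSUP_upper[OF W(1) bdd])
    finally show "measure M K \<le> (SUP U\<in>F. measure M (U `` {D}))" .
  qed
  show "(SUP U\<in>F. riesz_valuation \<psi> D (U `` {D})) \<le> riesz_valuation \<psi> D (\<Union>F `` {D})"
    unfolding M(2)
  proof (rule cSUP_least)
    show "F \<noteq> {}" using F(2) by (simp add: directed_def)
    show "measure M (U `` {D}) \<le> measure M (\<Union>F `` {D})" if "U \<in> F" for U
      using that sets by (intro M.finite_measure_mono) auto
  qed
qed

lemma state_valuation_lower_reals:
  assumes U: "U \<in> opens A C"
  shows "state_valuation A \<psi> C U \<in> lower_reals A C"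
  unfolding lower_reals_def
proof (intro CollectI conjI ballI impI)
  have "riesz_valuation \<psi> D B \<in> {0..1}" if "D \<in> down A C" for D B
    using that riesz_valuation_bounds(1,2) by (simp add: down_def)
  then show "state_valuation A \<psi> C U \<in> down A C \<rightarrow>\<^sub>E {0..1}"
    unfolding state_valuation_def restrict_PiE_iff by blast
next
  fix D E assume D: "D \<in> down A C" and E: "E \<in> down A C" and DE: "D \<subseteq> E"
  have "riesz_valuation \<psi> E (U `` {E}) \<le> riesz_valuation \<psi> D (U `` {D})"
  proof (rule riesz_valuation_mono[OF _ _ DE opens_slice[OF U E] opens_slice[OF U D]])
    show "D \<in> contexts A" "E \<in> contexts A" using D E by (simp_all add: down_def)
    show "restrict l D \<in> U `` {D}" if "l \<in> U `` {E}" for l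
      using opens_restrict[OF U D DE that] .
  qed
  then show "state_valuation A \<psi> C U E \<le> state_valuation A \<psi> C U D"
    using D E by (simp add: state_valuation_def)
qed

lemma state_valuation_restrict:
  assumes D: "D \<in> down A C" and U: "U \<in> opens A C"
  shows "state_valuation A \<psi> D (U \<inter> Sigma_down A D) = restrict (state_valuation A \<psi> C U) (down A D)"
proof
  fix E
  have "(U \<inter> Sigma_down A D) `` {E} = U `` {E}" if "E \<in> down A D"
  proof -
    have "openin (gelfand_topology E) (U `` {E})"
      using that D by (intro opens_slice[OF U]) (rule down_trans)
    then have "U `` {E} \<subseteq> gelfand_spectrum E"
      using openin_subset by fastforce
    with that show ?thesis by (auto simp: Sigma_down_def)
  qed
  then show "state_valuation A \<psi> D (U \<inter> Sigma_down A D) E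
      = restrict (state_valuation A \<psi> C U) (down A D) E"
    using down_trans[OF D] by (simp add: state_valuation_def restrict_def)
qed

end

theorem lemma3p20:
  fixes A :: "'h::chilbert_space op set" and \<psi> :: "'h op \<Rightarrow> complex"
  assumes "von_neumann_algebra A"
    and "state_on A \<psi>"
  shows "probability_valuation A (state_valuation A \<psi>)"
proof -
  interpret von_neumann_state A \<psi> using assms by unfold_locales
  show ?thesis
    unfolding probability_valuation_def
  proof (intro conjI ballI allI impI)
    fix C U assume "U \<in> opens A C"
    then show "state_valuation A \<psi> C U \<in> lower_reals A C"
      by (rule state_valuation_lower_reals)
  next
    fix C D U assume "D \<in> down A C" "U \<in> opens A C"
    then show "state_valuation A \<psi> D (U \<inter> Sigma_down A D) = restrict (state_valuation A \<psi> C U) (down A D)"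
      by (rule state_valuation_restrict)
  next
    fix C D assume D: "D \<in> down A C"
    then have DA: "D \<in> contexts A" by (simp add: down_def)
    have val: "state_valuation A \<psi> C U D = riesz_valuation \<psi> D (U `` {D})" for U
      using D by (simp add: state_valuation_def)
    show "state_valuation A \<psi> C {} D = 0"
      by (simp add: val riesz_valuation_bounds[OF DA])
    have "Sigma_down A C `` {D} = gelfand_spectrum D"
      using D by (auto simp: Sigma_down_def)
    then show "state_valuation A \<psi> C (Sigma_down A C) D = 1"
      by (simp add: val riesz_valuation_bounds[OF DA])
    {
      fix U V assume U: "U \<in> opens A C" and V: "V \<in> opens A C"
      note slices = opens_slice[OF U D] opens_slice[OF V D]
      show "state_valuation A \<psi> C U D + state_valuation A \<psi> C V D
          = state_valuation A \<psi> C (U \<inter> V) D + state_valuation A \<psi> C (U \<union> V) D"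
      proof -
        have "(U \<inter> V) `` {D} = U `` {D} \<inter> V `` {D}" "(U \<union> V) `` {D} = U `` {D} \<union> V `` {D}"
          by blast+
        then show ?thesis
          using riesz_valuation_modular[OF DA slices] by (simp add: val)
      qed
      assume UV: "U \<subseteq> V"
      \<comment> \<open>The case of equal contexts: restriction to \<open>D\<close> maps the slice
        of \<open>U\<close> at \<open>D\<close> into itself, and so into that of
        \<open>V\<close>.\<close>
      show "state_valuation A \<psi> C U D \<le> state_valuation A \<psi> C V D"
        unfolding val using UV opens_restrict[OF U D]
        by (intro riesz_valuation_mono[OF DA DA _ slices]) blast+
    }
    fix F assume "F \<subseteq> opens A C" "directed F"
    then show "state_valuation A \<psi> C (\<Union>F) D = (SUP U\<in>F. state_valuation A \<psi> C U D)"
      unfolding val using D by (intro riesz_valuation_directed_Union)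
  qed
qed

end
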